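(* Let $n\ge2$ be an integer and $\alpha>0$ with $\alpha\ne1$. If $u$ solves $$\alpha P_n u+(n-1)!\left(1-\frac{e^{nu}}{\int_{\mathbb{S}^n}e^{nu}\,dw}\right)=0\quad\text{on }\mathbb{S}^n,$$ then $$\int_{\mathbb{S}^n}e^{nu}\xi_i\,dw=0\quad\text{and}\quad\int_{\mathbb{S}^n}u\,\xi_i\,dw=0,\qquad i=1,2,\dots,n+1.$$
   Context: $\mathbb{S}^n\subset\mathbb{R}^{n+1}$ is the unit sphere with its round metric, with coordinates $\xi=(\xi_1,\dots,\xi_{n+1})$; $\Delta$ is the Laplace–Beltrami operator; $dw$ is the volume form normalized so that $\int_{\mathbb{S}^n}dw=1$. The Paneitz operator is $$P_n=\prod_{k=0}^{\frac{n-2}{2}}\bigl(-\Delta+k(n-k-1)\bigr)\ \text{ for } n \text{ even},\qquad P_n=\Bigl(-\Delta+\bigl(\tfrac{n-1}{2}\bigr)^2\Bigr)^{1/2}\prod_{k=0}^{\frac{n-3}{2}}\bigl(-\Delta+k(n-k-1)\bigr)\ \text{ for } n\text{ odd}$$ (defined spectrally; $P_n$ acts on spherical harmonics of degree $k$ as multiplication by $\prod_{s=0}^{n-1}(k+s)$). Solutions are understood to be smooth functions on $\mathbb{S}^n$ (no symmetry is assumed). *)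

theory Defs
  imports "HOL-Analysis.Analysis"
begin

section \<open>Smooth functions on the unit sphere\<close>

text \<open>For open \<open>S\<close>. Quantifying over all directions \<open>v\<close> (not just a basis) makes every mixed
  directional derivative of order at most \<open>k\<close> exist and be continuous.\<close>

primrec C_k_on :: "nat \<Rightarrow> 'a::euclidean_space set \<Rightarrow> ('a \<Rightarrow> real) \<Rightarrow> bool" where
  "C_k_on 0 S f \<longleftrightarrow> continuous_on S f"
| "C_k_on (Suc k) S f \<longleftrightarrow>
     (\<forall>x\<in>S. f differentiable (at x)) \<and>
     (\<forall>v. C_k_on k S (\<lambda>x. frechet_derivative f (at x) v))"

definition smooth_on :: "'a::euclidean_space set \<Rightarrow> ('a \<Rightarrow> real) \<Rightarrow> bool" where
  "smooth_on S f \<longleftrightarrow> (\<forall>k. C_k_on k S f)"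

text \<open>A function on the sphere is represented by a function on the ambient space whose values off
  the sphere are irrelevant. It is smooth if it is the restriction of a smooth function defined
  near the sphere.\<close>

definition smooth_on_sphere :: "('a::euclidean_space \<Rightarrow> real) \<Rightarrow> bool" where
  "smooth_on_sphere f \<longleftrightarrow>
     (\<exists>U F. open U \<and> sphere 0 1 \<subseteq> U \<and> smooth_on U F \<and> (\<forall>x\<in>sphere 0 1. F x = f x))"


section \<open>The normalized volume of the unit sphere\<close>

text \<open>The rotation-invariant probability measure on the sphere: the image of the uniform
  distribution on the unit ball under \<open>x \<mapsto> x / \<bar>x\<bar>\<close>. Thus the measure of a Borel set \<open>A\<close> is the
  proportion of the ball occupied by the cone over \<open>A\<close>, which by polar coordinates is the
  proportion of the Riemannian volume of the sphere occupied by \<open>A\<close>.\<close>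

definition sphere_measure :: "'a::euclidean_space measure" where
  "sphere_measure =
     restrict_space (distr (uniform_measure lborel (ball 0 1)) borel sgn) (sphere 0 1)"


section \<open>The Laplace--Beltrami operator\<close>

definition laplacian :: "('a::euclidean_space \<Rightarrow> real) \<Rightarrow> 'a \<Rightarrow> real" where
  "laplacian F x =
     (\<Sum>b\<in>Basis. frechet_derivative (\<lambda>y. frechet_derivative F (at y) b) (at x) b)"

text \<open>On the unit sphere the Laplace--Beltrami operator is the Euclidean Laplacian of the extension
  \<open>y \<mapsto> f (y / \<bar>y\<bar>)\<close> that is homogeneous of degree 0: the radial part of the Euclidean Laplacian
  annihilates that extension. Here \<open>sgn y = y / \<bar>y\<bar>\<close>.\<close>

definition laplace_beltrami :: "('a::euclidean_space \<Rightarrow> real) \<Rightarrow> 'a \<Rightarrow> real" where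
  "laplace_beltrami f x = laplacian (\<lambda>y. f (sgn y)) x"

definition laplace_eigenfunction :: "real \<Rightarrow> ('a::euclidean_space \<Rightarrow> real) \<Rightarrow> bool" where
  "laplace_eigenfunction \<mu> Y \<longleftrightarrow>
     smooth_on_sphere Y \<and> (\<forall>x\<in>sphere 0 1. - laplace_beltrami Y x = \<mu> * Y x)"


section \<open>The Paneitz operator\<close>

text \<open>The Paneitz operator on the \<open>n\<close>-sphere is the function \<open>paneitz_symbol n\<close> of \<open>-\<Delta>\<close>.\<close>

definition paneitz_symbol :: "nat \<Rightarrow> real \<Rightarrow> real" where
  "paneitz_symbol n \<mu> =
     (if even n
      then \<Prod>k = 0..(n - 2) div 2. \<mu> + real k * (real n - real k - 1)
      else sqrt (\<mu> + ((real n - 1) / 2)\<^sup>2) *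
           (\<Prod>k = 0..(n - 3) div 2. \<mu> + real k * (real n - real k - 1)))"

text \<open>The graph of the Paneitz operator on smooth functions, given by the spectral decomposition of
  \<open>-\<Delta>\<close>: applying the operator multiplies the component of \<open>u\<close> in the \<open>\<mu>\<close>-eigenspace by
  \<open>paneitz_symbol n \<mu>\<close>. Since the eigenfunctions are complete, \<open>v\<close> is determined on the sphere by
  \<open>u\<close>.\<close>

definition has_paneitz ::
  "nat \<Rightarrow> ('a::euclidean_space \<Rightarrow> real) \<Rightarrow> ('a \<Rightarrow> real) \<Rightarrow> bool" where
  "has_paneitz n u v \<longleftrightarrow>
     smooth_on_sphere u \<and> smooth_on_sphere v \<and>
     (\<forall>\<mu> Y. laplace_eigenfunction \<mu> Y \<longrightarrow>
        (LINT x|sphere_measure. v x * Y x) =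
        paneitz_symbol n \<mu> * (LINT x|sphere_measure. u x * Y x))"

text \<open>The spherical harmonics of degree \<open>k\<close> have eigenvalue \<open>k (k + n - 1)\<close>; the symbol then takes
  the familiar form.\<close>

lemma paneitz_symbol_harmonic:
  assumes "n \<ge> 2"
  shows "paneitz_symbol n (real k * (real k + real n - 1)) = (\<Prod>s<n. real k + real s)"
proof -
  define m where "m = n div 2"
  define lam where "lam = real k * (real k + real n - 1)"
  have fac: "lam + real j * (real n - real j - 1) = (real k + real j) * (real k + (real n - 1 - real j))"
    for j by (simp add: lam_def algebra_simps)
  have m1: "m \<ge> 1" using assms by (simp add: m_def)
  have reflected: "(\<Prod>j<m. real k + (real n - 1 - real j)) = (\<Prod>s\<in>{n-m..<n}. real k + real s)"
    by (rule prod.reindex_bij_witness[where i = "\<lambda>s. n - 1 - s" and j = "\<lambda>j. n - 1 - j"])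
       (use assms in \<open>auto simp: m_def of_nat_diff\<close>)
  have prods: "(\<Prod>j<m. lam + real j * (real n - real j - 1)) =
      (\<Prod>s<m. real k + real s) * (\<Prod>s\<in>{n-m..<n}. real k + real s)"
    unfolding fac prod.distrib reflected ..
  show ?thesis
  proof (cases "even n")
    case True
    then have nm: "n = 2 * m" by (simp add: m_def)
    have "{0..(n - 2) div 2} = {..<m}" using nm m1 by auto
    then have "paneitz_symbol n lam = (\<Prod>s<m. real k + real s) * (\<Prod>s\<in>{m..<n}. real k + real s)"
      using True prods nm by (simp add: paneitz_symbol_def)
    also have "\<dots> = (\<Prod>s<n. real k + real s)"
      using prod.atLeastLessThan_concat[of 0 m n "\<lambda>s. real k + real s"] nm
      by (simp add: lessThan_atLeast0)
    finally show ?thesis by (simp add: lam_def)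
  next
    case False
    then have nm: "n = 2 * m + 1" by (simp add: m_def)
    have "{0..(n - 3) div 2} = {..<m}" using nm m1 by auto
    moreover have "lam + ((real n - 1) / 2)\<^sup>2 = (real k + real m)\<^sup>2"
      by (simp add: lam_def nm power2_eq_square algebra_simps)
    then have "sqrt (lam + ((real n - 1) / 2)\<^sup>2) = real k + real m" by simp
    ultimately have "paneitz_symbol n lam =
        (real k + real m) * ((\<Prod>s<m. real k + real s) * (\<Prod>s\<in>{Suc m..<n}. real k + real s))"
      using False prods nm by (simp add: paneitz_symbol_def)
    also have "\<dots> = (\<Prod>s<Suc m. real k + real s) * (\<Prod>s\<in>{Suc m..<n}. real k + real s)"
      by simp
    also have "\<dots> = (\<Prod>s<n. real k + real s)"
      using prod.atLeastLessThan_concat[of 0 "Suc m" n "\<lambda>s. real k + real s"] nm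
      by (simp add: lessThan_atLeast0)
    finally show ?thesis by (simp add: lam_def)
  qed
qed

end

theory Submission
  imports Defs
begin

text \<open>
  Let \<open>X\<close> be the derivative along the gradient of the coordinate \<open>\<xi> = \<xi>\<^sub>i\<close> on the sphere, so that
  \<open>\<integral> X f = n \<integral> f \<xi>\<close> for every \<open>f\<close>. The key is the identity \<open>\<integral> (P\<^sub>n u) (X u) = 0\<close> for all smooth \<open>u\<close>,
  the infinitesimal form of the conformal invariance of \<open>P\<^sub>n\<close>. It is spectral: if \<open>Y\<close> is a spherical
  harmonic of degree \<open>k\<close> and \<open>\<xi> Y = Y\<^sub>+ + Y\<^sub>-\<close> with \<open>Y\<^sub>+\<close>, \<open>Y\<^sub>-\<close> of degrees \<open>k + 1\<close>, \<open>k - 1\<close>, then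
  \<open>X Y = (k + n - 1) Y\<^sub>- - k Y\<^sub>+\<close>, and the eigenvalues \<open>p k\<close> of \<open>P\<^sub>n\<close> satisfy
  \<open>k p (k + 1) = (k + n) p k\<close>, which makes the contributions of neighbouring degrees cancel.

  Testing the equation against \<open>X u\<close> then gives \<open>\<integral> e\<^sup>n\<^sup>u \<xi> / \<integral> e\<^sup>n\<^sup>u = n \<integral> u \<xi>\<close>, because
  \<open>n \<integral> e\<^sup>n\<^sup>u (X u) = \<integral> X (e\<^sup>n\<^sup>u) = n \<integral> e\<^sup>n\<^sup>u \<xi>\<close>. Testing it against \<open>\<xi>\<close>, where \<open>P\<^sub>n \<xi> = n! \<xi>\<close>, gives
  \<open>\<alpha> n! \<integral> u \<xi> = (n - 1)! \<integral> e\<^sup>n\<^sup>u \<xi> / \<integral> e\<^sup>n\<^sup>u = n! \<integral> u \<xi>\<close>, and both integrals vanish when \<open>\<alpha> \<noteq> 1\<close>.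
\<close>

section \<open>The rotation-invariant measure on the sphere\<close>

lemma nn_integral_lborel_translate:
  fixes f :: "'a::euclidean_space \<Rightarrow> ennreal"
  assumes [measurable]: "f \<in> borel_measurable borel"
  shows "(\<integral>\<^sup>+x. f (c + x) \<partial>lborel) = (\<integral>\<^sup>+x. f x \<partial>lborel)"
  by (subst (2) lborel_distr_plus[symmetric, of c]) (simp add: nn_integral_distr)

text \<open>A double integral with a rotation-invariant weight reduces this to translations. In the
  integral of \<open>f (R x) * g y\<close>, with \<open>g\<close> the indicator of the unit ball,
  translating \<open>x\<close> by \<open>?S y\<close> and then \<open>y\<close> by
  \<open>- R x\<close> turns the integrand into \<open>f y * g (y - R x)\<close>. The weight still
  integrates to \<open>V\<close> over \<open>x\<close>, and \<open>V\<close> cancels because it is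
  positive and finite.\<close>

lemma nn_integral_lborel_orthogonal:
  fixes f :: "'a::euclidean_space \<Rightarrow> ennreal" and R :: "'a \<Rightarrow> 'a"
  assumes R: "orthogonal_transformation R" and [measurable]: "f \<in> borel_measurable borel"
  shows "(\<integral>\<^sup>+x. f (R x) \<partial>lborel) = (\<integral>\<^sup>+x. f x \<partial>lborel)"
proof -
  let ?S = "inv R"
  have S: "orthogonal_transformation ?S"
    using R by (rule orthogonal_transformation_inv)
  have RS: "R (?S y) = y" for y
    using R by (simp add: orthogonal_transformation_surj surj_f_inv_f)
  have SR: "?S (R y) = y" for y
    using R by (simp add: orthogonal_transformation_inj)
  have lin: "linear R" "linear ?S"
    using R S by (auto simp: orthogonal_transformation_def)
  have [measurable]: "R \<in> borel_measurable borel" "?S \<in> borel_measurable borel"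
    using lin by (auto intro!: borel_measurable_continuous_onI linear_continuous_on linear_conv_bounded_linear[THEN iffD1])
  define g :: "'a \<Rightarrow> ennreal" where "g = indicator (ball 0 1)"
  have [measurable]: "g \<in> borel_measurable borel" unfolding g_def by (intro borel_measurable_indicator) simp
  define V where "V = (\<integral>\<^sup>+y. g y \<partial>lborel)"
  have V: "V = emeasure lborel (ball (0::'a) 1)" by (simp add: V_def g_def)
  have V0: "V \<noteq> 0" unfolding V by (simp add: emeasure_lborel_ball_finite emeasure_ball less_imp_neq[symmetric])
  have Vtop: "V \<noteq> \<infinity>" unfolding V using emeasure_lborel_ball_finite[of "0::'a" 1] by (auto simp: less_top)
  \<comment> \<open>\<open>R\<close> preserves the norm, so as a function of \<open>x\<close> the
    weight is a translate of the ball indicator.\<close>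
  have gV: "(\<integral>\<^sup>+x. g (y - R x) \<partial>lborel) = V" for y
  proof -
    have "g (y - R x) = g (- ?S y + x)" for x
    proof -
      have "norm (y - R x) = norm (R (?S y - x))" using lin(1) by (simp add: linear_diff RS)
      also have "\<dots> = norm (?S y - x)" using R by (simp add: orthogonal_transformation_norm)
      also have "\<dots> = norm (- ?S y + x)" by (metis norm_minus_commute uminus_add_conv_diff)
      finally show ?thesis by (simp add: g_def indicator_def)
    qed
    then show ?thesis unfolding V_def by (simp only: nn_integral_lborel_translate \<open>g \<in> borel_measurable borel\<close>)
  qed
  have "(\<integral>\<^sup>+x. f (R x) \<partial>lborel) * V = (\<integral>\<^sup>+y. \<integral>\<^sup>+x. f (R x) * g y \<partial>lborel \<partial>lborel)"
    unfolding V_def by (simp add: nn_integral_cmult nn_integral_multc)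
  also have "\<dots> = (\<integral>\<^sup>+y. \<integral>\<^sup>+x. f (R (?S y + x)) * g y \<partial>lborel \<partial>lborel)"
    by (subst nn_integral_lborel_translate[where f = "\<lambda>x. f (R x) * g _"]) auto
  also have "\<dots> = (\<integral>\<^sup>+y. \<integral>\<^sup>+x. f (y + R x) * g y \<partial>lborel \<partial>lborel)"
    using lin(1) by (simp add: linear_add RS)
  also have "\<dots> = (\<integral>\<^sup>+x. \<integral>\<^sup>+y. f (y + R x) * g y \<partial>lborel \<partial>lborel)"
    by (rule lborel_pair.Fubini'[symmetric]) simp
  also have "\<dots> = (\<integral>\<^sup>+x. \<integral>\<^sup>+y. f y * g (y - R x) \<partial>lborel \<partial>lborel)"
  proof (rule nn_integral_cong)
    fix x
    show "(\<integral>\<^sup>+y. f (y + R x) * g y \<partial>lborel) = (\<integral>\<^sup>+y. f y * g (y - R x) \<partial>lborel)"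
      using nn_integral_lborel_translate[of "\<lambda>y. f y * g (y - R x)" "R x"] by (simp add: add.commute)
  qed
  also have "\<dots> = (\<integral>\<^sup>+y. \<integral>\<^sup>+x. f y * g (y - R x) \<partial>lborel \<partial>lborel)"
    by (rule lborel_pair.Fubini') simp
  also have "\<dots> = (\<integral>\<^sup>+y. f y \<partial>lborel) * V"
    by (simp add: nn_integral_cmult nn_integral_multc gV)
  finally show ?thesis
    using V0 Vtop by (metis mult_divide_eq_ennreal infinity_ennreal_def)
qed

section \<open>The cone measure on the sphere and its rotation invariance\<close>

lemma borel_measurable_sgn_euclidean [measurable]:
  "(sgn :: 'a::euclidean_space \<Rightarrow> 'a) \<in> borel_measurable borel"
  unfolding sgn_div_norm[abs_def] by measurable

lemma space_sphere_measure [simp]: "space sphere_measure = sphere (0::'a::euclidean_space) 1"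
  by (simp add: sphere_measure_def space_restrict_space)

lemma emeasure_sphere_measure:
  fixes A :: "'a::euclidean_space set"
  assumes "A \<in> sets borel" "A \<subseteq> sphere 0 1"
  shows "emeasure sphere_measure A = emeasure lborel (ball 0 1 \<inter> sgn -` A) / emeasure lborel (ball (0::'a) 1)"
proof -
  have [measurable]: "A \<in> sets borel" by fact
  have "sgn -` A \<in> sets (borel :: 'a measure)"
    using measurable_sets_borel[OF borel_measurable_sgn_euclidean, of A] by simp
  then show ?thesis
    using assms by (simp add: sphere_measure_def emeasure_restrict_space emeasure_distr)
qed

lemma emeasure_space_sphere_measure:
  "emeasure sphere_measure (sphere (0::'a::euclidean_space) 1) = 1"
proof -
  have "emeasure lborel (ball 0 1 \<inter> sgn -` sphere (0::'a) 1) = emeasure lborel (ball (0::'a) 1)"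
  proof (rule emeasure_eq_AE)
    \<comment> \<open>The centre, where \<open>sgn\<close> is 0, is the only point of the ball
      outside the cone over the sphere.\<close>
    have "AE x in lborel. x \<notin> {0::'a}" by (rule AE_not_in) (simp add: finite_imp_null_set_lborel)
    then show "AE x in lborel. (x \<in> ball 0 1 \<inter> sgn -` sphere (0::'a) 1) = (x \<in> ball (0::'a) 1)"
      by eventually_elim (auto simp: norm_sgn)
    show "ball 0 1 \<inter> sgn -` sphere (0::'a) 1 \<in> sets (lborel::'a measure)"
      using measurable_sets_borel[OF borel_measurable_sgn_euclidean, of "sphere (0::'a) 1"] by simp
  qed simp
  moreover have "emeasure lborel (ball (0::'a) 1) \<noteq> 0" "emeasure lborel (ball (0::'a) 1) \<noteq> \<infinity>"
    using emeasure_lborel_ball_finite[of "0::'a" 1]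
    by (auto simp: emeasure_ball less_imp_neq[symmetric])
  ultimately show ?thesis
    by (simp add: emeasure_sphere_measure less_top zero_less_iff_neq_zero)
qed

lemma finite_measure_sphere_measure: "finite_measure (sphere_measure :: 'a::euclidean_space measure)"
  by (rule finite_measureI) (simp add: emeasure_space_sphere_measure)

lemma sets_sphere_measure:
  "sets (sphere_measure :: 'a::euclidean_space measure) = {A. A \<in> sets borel \<and> A \<subseteq> sphere 0 1}"
  unfolding sphere_measure_def set_eq_iff mem_Collect_eq by (subst sets_restrict_space_iff) (simp, simp, blast)

lemma borel_measurable_sphere_measure:
  fixes f :: "'a::euclidean_space \<Rightarrow> 'b::topological_space"
  assumes "continuous_on (sphere 0 1) f"
  shows "f \<in> borel_measurable sphere_measure"
proof -
  have "f \<in> borel_measurable (restrict_space borel (sphere 0 1))"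
    using assms by (rule borel_measurable_continuous_on_restrict)
  moreover have "sets sphere_measure = sets (restrict_space borel (sphere (0::'a) 1))"
    unfolding sphere_measure_def by (intro sets_restrict_space_cong) simp
  ultimately show ?thesis by (simp cong: measurable_cong_sets)
qed

text \<open>\<open>R\<close> commutes with \<open>sgn\<close> and preserves the unit ball, so the
  cone over the preimage of \<open>A\<close> is the preimage of the cone over \<open>A\<close>;
  invariance of Lebesgue measure does the rest.\<close>

lemma distr_sphere_measure_orthogonal:
  fixes R :: "'a::euclidean_space \<Rightarrow> 'a"
  assumes R: "orthogonal_transformation R"
  shows "R \<in> measurable sphere_measure sphere_measure"
    and "distr sphere_measure sphere_measure R = sphere_measure"
proof -
  have lin: "linear R" using R by (simp add: orthogonal_transformation_def)
  have nR: "norm (R x) = norm x" for x using R by (simp add: orthogonal_transformation_norm)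
  have contR: "continuous_on S R" for S
    using lin by (auto intro!: linear_continuous_on linear_conv_bounded_linear[THEN iffD1])
  have Rb: "R \<in> borel_measurable borel" using contR by (rule borel_measurable_continuous_onI)
  have vim: "R -` A \<inter> sphere 0 1 \<in> sets borel" if "A \<in> sets borel" for A
    using measurable_sets_borel[OF Rb that] by (intro sets.Int) auto
  show meas: "R \<in> measurable sphere_measure sphere_measure"
    by (rule measurableI) (auto simp: nR sets_sphere_measure vim)
  show "distr sphere_measure sphere_measure R = sphere_measure"
  proof (rule measure_eqI)
    fix A assume "A \<in> sets (distr sphere_measure sphere_measure R)"
    then have A: "A \<in> sets borel" "A \<subseteq> sphere 0 1" by (auto simp: sets_sphere_measure)
    let ?B = "\<lambda>A. ball 0 1 \<inter> sgn -` A :: 'a set"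
    have B: "?B A \<in> sets borel" if "A \<in> sets borel" for A
      using measurable_sets_borel[OF borel_measurable_sgn_euclidean, of A] that by simp
    have sgnR: "sgn (R x) = R (sgn x)" for x
      using lin by (simp add: sgn_div_norm nR linear_scale)
    have "emeasure (distr sphere_measure sphere_measure R) A = emeasure sphere_measure (R -` A \<inter> sphere 0 1)"
      using A meas by (subst emeasure_distr) (auto simp: sets_sphere_measure)
    also have "\<dots> = emeasure lborel (?B (R -` A \<inter> sphere 0 1)) / emeasure lborel (ball (0::'a) 1)"
      using A(1) by (intro emeasure_sphere_measure vim) auto
    also have "emeasure lborel (?B (R -` A \<inter> sphere 0 1)) = (\<integral>\<^sup>+x. indicator (?B (R -` A \<inter> sphere 0 1)) x \<partial>lborel)"
      using A(1) by (intro nn_integral_indicator[symmetric]) (simp only: sets_lborel B vim)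
    also have "\<dots> = (\<integral>\<^sup>+x. indicator (?B A) (R x) \<partial>lborel)"
    proof (rule nn_integral_cong)
      fix x :: 'a
      have "norm (R (sgn x)) = 1" if "R (sgn x) \<in> A" using A(2) that by auto
      then show "indicator (?B (R -` A \<inter> sphere 0 1)) x = (indicator (?B A) (R x) :: ennreal)"
        by (auto simp: indicator_def sgnR nR)
    qed
    also have "\<dots> = (\<integral>\<^sup>+x. indicator (?B A) x \<partial>lborel)"
      using A(1) B by (intro nn_integral_lborel_orthogonal R) auto
    also have "\<dots> = emeasure lborel (?B A)"
      using A(1) B by (intro nn_integral_indicator) auto
    finally show "emeasure (distr sphere_measure sphere_measure R) A = emeasure sphere_measure A"
      by (simp add: emeasure_sphere_measure[OF A])
  qed simp
qed

lemma integral_sphere_measure_orthogonal: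
  fixes f :: "'a::euclidean_space \<Rightarrow> real" and R :: "'a \<Rightarrow> 'a"
  assumes "orthogonal_transformation R" "continuous_on (sphere 0 1) f"
  shows "(LINT x|sphere_measure. f (R x)) = (LINT x|sphere_measure. f x)"
  using integral_distr[OF distr_sphere_measure_orthogonal(1)[OF assms(1)] borel_measurable_sphere_measure[OF assms(2)]]
  by (simp add: distr_sphere_measure_orthogonal(2)[OF assms(1)])

lemma integrable_sphere_measure:
  fixes f :: "'a::euclidean_space \<Rightarrow> real"
  assumes "continuous_on (sphere 0 1) f"
  shows "integrable sphere_measure f"
proof -
  interpret finite_measure "sphere_measure :: 'a measure" by (rule finite_measure_sphere_measure)
  have "bounded (f ` sphere 0 1)"
    using assms by (intro compact_imp_bounded compact_continuous_image) auto
  then obtain B where "\<And>x. x \<in> sphere 0 1 \<Longrightarrow> norm (f x) \<le> B"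
    unfolding bounded_iff by blast
  then show ?thesis
    by (intro integrable_const_bound[of _ B] borel_measurable_sphere_measure assms AE_I2) simp
qed

lemma measure_sphere_measure [simp]:
  "measure sphere_measure (sphere (0::'a::euclidean_space) 1) = 1"
  by (simp add: measure_def emeasure_space_sphere_measure)

section \<open>Divergence of coordinate fields\<close>

text \<open>The derivative is that of the ambient space, taken at points of the sphere only. It can
  thus be applied to vectors that are not tangent, which lets \<open>coord_flow\<close> be split
  into its \<open>b\<close> part and its radial part.\<close>

definition C1_on_sphere :: "('a::euclidean_space \<Rightarrow> real) \<Rightarrow> bool" where
  "C1_on_sphere F \<longleftrightarrow> (\<forall>x\<in>sphere 0 1. F differentiable (at x)) \<and>
     (\<forall>v. continuous_on (sphere 0 1) (\<lambda>x. frechet_derivative F (at x) v))"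

text \<open>The derivative of \<open>F\<close> along the gradient on the sphere of the coordinate \<open>x \<bullet> b\<close>.\<close>

definition coord_flow :: "'a::euclidean_space \<Rightarrow> ('a \<Rightarrow> real) \<Rightarrow> 'a \<Rightarrow> real" where
  "coord_flow b F x = frechet_derivative F (at x) (b - (x \<bullet> b) *\<^sub>R x)"

text \<open>For orthonormal \<open>b\<close> and \<open>c\<close> this is the rotation by the angle
  \<open>t\<close> that turns \<open>b\<close> towards \<open>c\<close> and fixes the orthogonal
  complement of their plane.\<close>

definition plane_rotation :: "'a::euclidean_space \<Rightarrow> 'a \<Rightarrow> real \<Rightarrow> 'a \<Rightarrow> 'a" where
  "plane_rotation b c t x = x + (cos t - 1) *\<^sub>R ((x \<bullet> b) *\<^sub>R b + (x \<bullet> c) *\<^sub>R c) +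
     sin t *\<^sub>R ((x \<bullet> b) *\<^sub>R c - (x \<bullet> c) *\<^sub>R b)"

lemma C1_on_sphere_imp_continuous_on:
  "C1_on_sphere F \<Longrightarrow> continuous_on (sphere 0 1) F"
  unfolding C1_on_sphere_def
  by (meson continuous_at_imp_continuous_on differentiable_imp_continuous_within)

lemma C1_on_sphere_has_derivative:
  "C1_on_sphere F \<Longrightarrow> x \<in> sphere 0 1 \<Longrightarrow> (F has_derivative frechet_derivative F (at x)) (at x)"
  unfolding C1_on_sphere_def using frechet_derivative_works by blast

text \<open>Continuity is given for each fixed direction; expanding \<open>w x\<close> in the basis
  extends it to a direction that varies with \<open>x\<close>.\<close>

lemma C1_on_sphere_continuous_on_derivative:
  assumes F: "C1_on_sphere F" and w: "continuous_on (sphere 0 1) w"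
  shows "continuous_on (sphere 0 1) (\<lambda>x. frechet_derivative F (at x) (w x))"
proof -
  have "continuous_on (sphere 0 1) (\<lambda>x. \<Sum>c\<in>Basis. (w x \<bullet> c) * frechet_derivative F (at x) c)"
    using F w unfolding C1_on_sphere_def by (intro continuous_intros) auto
  moreover have "(\<Sum>c\<in>Basis. (w x \<bullet> c) * frechet_derivative F (at x) c) = frechet_derivative F (at x) (w x)"
    if "x \<in> sphere 0 1" for x
  proof -
    interpret D: linear "frechet_derivative F (at x)"
      using C1_on_sphere_has_derivative[OF F that] by (rule has_derivative_linear)
    have "frechet_derivative F (at x) (w x) = frechet_derivative F (at x) (\<Sum>c\<in>Basis. (w x \<bullet> c) *\<^sub>R c)"
      by (simp add: euclidean_representation)
    then show ?thesis by (simp add: D.sum D.scaleR)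
  qed
  ultimately show ?thesis by (rule continuous_on_eq)
qed

lemma continuous_on_coord_flow:
  "C1_on_sphere F \<Longrightarrow> continuous_on (sphere 0 1) (coord_flow b F)"
  unfolding coord_flow_def[abs_def]
  by (rule C1_on_sphere_continuous_on_derivative) (auto intro!: continuous_intros)

lemma C1_on_sphereI:
  assumes D: "\<And>x. x \<in> sphere 0 1 \<Longrightarrow> (F has_derivative D x) (at x)"
    and c: "\<And>v. continuous_on (sphere 0 1) (\<lambda>x. D x v)"
  shows "C1_on_sphere F"
proof -
  have *: "frechet_derivative F (at x) = D x" if "x \<in> sphere 0 1" for x
    using D[OF that] by (rule frechet_derivative_at[symmetric])
  show ?thesis
    unfolding C1_on_sphere_def
  proof (intro conjI ballI allI)
    show "F differentiable (at x)" if "x \<in> sphere 0 1" for x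
      using D[OF that] by (rule differentiableI)
    show "continuous_on (sphere 0 1) (\<lambda>x. frechet_derivative F (at x) v)" for v
      using c[of v] by (rule continuous_on_eq) (simp add: *)
  qed
qed

lemma C1_on_sphere_mult:
  assumes F: "C1_on_sphere F" and G: "C1_on_sphere G"
  shows "C1_on_sphere (\<lambda>x. F x * G x)"
proof (rule C1_on_sphereI)
  fix x :: 'a assume x: "x \<in> sphere 0 1"
  show "((\<lambda>x. F x * G x) has_derivative
      (\<lambda>v. F x * frechet_derivative G (at x) v + frechet_derivative F (at x) v * G x)) (at x)"
    by (intro has_derivative_mult C1_on_sphere_has_derivative assms x)
qed (intro continuous_intros C1_on_sphere_imp_continuous_on C1_on_sphere_continuous_on_derivative assms)

lemma frechet_derivative_mult:
  assumes "F differentiable (at x)" "G differentiable (at x)"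
  shows "frechet_derivative (\<lambda>x. F x * G x :: real) (at x) v =
    F x * frechet_derivative G (at x) v + frechet_derivative F (at x) v * G x"
proof -
  have "((\<lambda>x. F x * G x) has_derivative
      (\<lambda>v. F x * frechet_derivative G (at x) v + frechet_derivative F (at x) v * G x)) (at x)"
    by (rule has_derivative_mult[OF assms[unfolded frechet_derivative_works]])
  from frechet_derivative_at[OF this, symmetric] show ?thesis by (rule fun_cong)
qed

lemma coord_flow_mult:
  assumes "C1_on_sphere F" "C1_on_sphere G" "x \<in> sphere 0 1"
  shows "coord_flow b (\<lambda>x. F x * G x) x = F x * coord_flow b G x + coord_flow b F x * G x"
  unfolding coord_flow_def using assms by (intro frechet_derivative_mult) (auto simp: C1_on_sphere_def)

lemma has_derivative_exp_C1:
  assumes F: "C1_on_sphere F" and x: "x \<in> sphere 0 1"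
  shows "((\<lambda>x. exp (c * F x)) has_derivative
      (\<lambda>v. c * exp (c * F x) * frechet_derivative F (at x) v)) (at x)"
  by (rule derivative_eq_intros C1_on_sphere_has_derivative[OF F x] refl)+ (simp add: algebra_simps)

lemma C1_on_sphere_exp:
  assumes F: "C1_on_sphere F"
  shows "C1_on_sphere (\<lambda>x. exp (c * F x))"
  by (rule C1_on_sphereI, rule has_derivative_exp_C1[OF F])
    (assumption, intro continuous_intros C1_on_sphere_imp_continuous_on C1_on_sphere_continuous_on_derivative F)

lemma coord_flow_exp:
  assumes F: "C1_on_sphere F" and x: "x \<in> sphere 0 1"
  shows "coord_flow b (\<lambda>x. exp (c * F x)) x = c * exp (c * F x) * coord_flow b F x"
  unfolding coord_flow_def frechet_derivative_at[OF has_derivative_exp_C1[OF assms], symmetric] ..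

lemma C1_on_sphere_inner: "C1_on_sphere (\<lambda>x. x \<bullet> c)"
  by (rule C1_on_sphereI[where D = "\<lambda>x v. v \<bullet> c"]) (auto intro!: derivative_eq_intros)

lemma frechet_derivative_inner: "frechet_derivative (\<lambda>x. x \<bullet> c) (at x) v = v \<bullet> c"
proof -
  have "((\<lambda>x. x \<bullet> c) has_derivative (\<lambda>v. v \<bullet> c)) (at x)" by (auto intro!: derivative_eq_intros)
  from frechet_derivative_at[OF this, symmetric] show ?thesis by (rule fun_cong)
qed

section \<open>Plane rotations and integration by parts on the sphere\<close>

lemma orthogonal_plane_rotation:
  assumes "b \<in> Basis" "c \<in> Basis" "b \<noteq> c"
  shows "orthogonal_transformation (plane_rotation b c t)"
  unfolding orthogonal_transformation_def
proof
  show "linear (plane_rotation b c t)"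
    unfolding plane_rotation_def by (rule linearI) (simp_all add: inner_add_left algebra_simps)
  have bc: "b \<bullet> b = 1" "c \<bullet> c = 1" "b \<bullet> c = 0" "c \<bullet> b = 0"
    using assms by (auto simp: inner_Basis)
  show "\<forall>v w. plane_rotation b c t v \<bullet> plane_rotation b c t w = v \<bullet> w"
  proof (intro allI)
    fix v w :: 'a
    define p q where "p = cos t" and "q = sin t"
    have "plane_rotation b c t v \<bullet> plane_rotation b c t w =
      v \<bullet> w + (p\<^sup>2 + q\<^sup>2 - 1) * ((v \<bullet> b) * (w \<bullet> b) + (v \<bullet> c) * (w \<bullet> c))"
      unfolding plane_rotation_def p_def[symmetric] q_def[symmetric]
      by (simp add: inner_add_left inner_add_right inner_diff_left inner_diff_right bc
          inner_commute[of b w] inner_commute[of c w], simp add: algebra_simps power2_eq_square)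
    then show "plane_rotation b c t v \<bullet> plane_rotation b c t w = v \<bullet> w"
      by (simp add: p_def q_def)
  qed
qed

text \<open>The velocity is expressed at the rotated point: the rotations are the flow of one fixed
  field, so the derivative of \<open>F\<close> along an orbit is one function evaluated at the
  moving point.\<close>

lemma has_vector_derivative_plane_rotation:
  assumes "b \<in> Basis" "c \<in> Basis" "b \<noteq> c"
  shows "((\<lambda>t. plane_rotation b c t x) has_vector_derivative
    (plane_rotation b c t x \<bullet> b) *\<^sub>R c - (plane_rotation b c t x \<bullet> c) *\<^sub>R b) (at t)"
proof -
  have bc: "b \<bullet> b = 1" "c \<bullet> c = 1" "b \<bullet> c = 0" "c \<bullet> b = 0"
    using assms by (auto simp: inner_Basis)
  show ?thesis
    unfolding plane_rotation_def has_vector_derivative_def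
    by (auto intro!: derivative_eq_intros simp: inner_add_left inner_diff_left bc algebra_simps)
qed

text \<open>The integral of \<open>F\<close> composed with \<open>plane_rotation b c t\<close> does
  not depend on \<open>t\<close>, and the left-hand side is its derivative at \<open>t = 0\<close>.
  Dominated convergence along the step sizes \<open>h k\<close> exchanges limit and
  integral.\<close>

lemma integral_rotation_derivative_eq_0:
  assumes F: "C1_on_sphere F" and bc: "b \<in> Basis" "c \<in> Basis" "b \<noteq> c"
  shows "(LINT x|sphere_measure. frechet_derivative F (at x) ((x \<bullet> b) *\<^sub>R c - (x \<bullet> c) *\<^sub>R b)) = 0"
proof -
  define G where "G x = frechet_derivative F (at x) ((x \<bullet> b) *\<^sub>R c - (x \<bullet> c) *\<^sub>R b)" for x
  let ?R = "plane_rotation b c"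
  have ot: "orthogonal_transformation (?R t)" for t
    by (rule orthogonal_plane_rotation[OF bc])
  have RS: "?R t x \<in> sphere 0 1" if "x \<in> sphere 0 1" for t x
    using that orthogonal_transformation_norm[OF ot] by simp
  have contF: "continuous_on (sphere 0 1) F" by (rule C1_on_sphere_imp_continuous_on[OF F])
  have contR: "continuous_on (sphere 0 1) (?R t)" for t
    using ot by (auto simp: orthogonal_transformation_def intro!: linear_continuous_on linear_conv_bounded_linear[THEN iffD1])
  have contFR: "continuous_on (sphere 0 1) (\<lambda>x. F (?R t x))" for t
    by (rule continuous_on_compose2[OF contF contR]) (use RS in auto)
  have contG: "continuous_on (sphere 0 1) G"
    unfolding G_def[abs_def] by (intro C1_on_sphere_continuous_on_derivative F continuous_intros)
  have "bounded (G ` sphere 0 1)"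
    using contG by (intro compact_imp_bounded compact_continuous_image) auto
  then obtain M where M: "\<And>x. x \<in> sphere 0 1 \<Longrightarrow> norm (G x) \<le> M"
    unfolding bounded_iff by blast
  have der: "((\<lambda>t. F (?R t x)) has_real_derivative G (?R t x)) (at t)" if "x \<in> sphere 0 1" for x t
  proof -
    have "(F has_derivative frechet_derivative F (at (?R t x))) (at (?R t x))"
      by (rule C1_on_sphere_has_derivative[OF F RS[OF that]])
    from vector_derivative_diff_chain_within[OF has_vector_derivative_plane_rotation[OF bc] this[THEN has_derivative_at_withinI]]
    show ?thesis
      by (simp add: G_def o_def has_real_derivative_iff_has_vector_derivative)
  qed
  have R0: "?R 0 x = x" for x by (simp add: plane_rotation_def)
  define h :: "nat \<Rightarrow> real" where "h k = 1 / real (Suc k)" for k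
  have h0: "h k > 0" for k by (simp add: h_def)
  define s where "s k x = (F (?R (h k) x) - F x) / h k" for k x
  have s0: "(LINT x|sphere_measure. s k x) = 0" for k
    using integral_sphere_measure_orthogonal[OF ot contF, of "h k"]
    by (simp add: s_def integrable_sphere_measure contF contFR)
  have "(\<lambda>k. LINT x|sphere_measure. s k x) \<longlonglongrightarrow> (LINT x|sphere_measure. G x)"
  proof (rule integral_dominated_convergence[where w = "\<lambda>_. M"])
    show "G \<in> borel_measurable sphere_measure" "s k \<in> borel_measurable sphere_measure" for k
      unfolding s_def[abs_def] using h0[of k]
      by (auto intro!: borel_measurable_sphere_measure contG continuous_intros contF contFR)
    show "integrable sphere_measure (\<lambda>_::'a. M)" by (intro integrable_sphere_measure continuous_intros)
    show "AE x in sphere_measure. (\<lambda>k. s k x) \<longlonglongrightarrow> G x"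
    proof (rule AE_I2)
      fix x :: 'a assume "x \<in> space sphere_measure"
      then have "((\<lambda>t. F (?R t x)) has_real_derivative G x) (at 0)"
        using der[of x 0] by (simp add: R0)
      then have "((\<lambda>t. (F (?R t x) - F x) / t) \<longlongrightarrow> G x) (at 0)"
        by (simp add: DERIV_def R0)
      moreover have "filterlim h (at 0) sequentially"
        unfolding filterlim_at using h0 LIMSEQ_inverse_real_of_nat
        by (auto simp: h_def[abs_def] inverse_eq_divide less_imp_neq[symmetric])
      ultimately show "(\<lambda>k. s k x) \<longlonglongrightarrow> G x"
        unfolding s_def by (rule filterlim_compose)
    qed
    \<comment> \<open>The mean value theorem identifies each difference quotient with a value of
      \<open>G\<close> at a rotated point, so \<open>M\<close> bounds all of them.\<close>
    show "AE x in sphere_measure. norm (s k x) \<le> M" for k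
    proof (rule AE_I2)
      fix x :: 'a assume x: "x \<in> space sphere_measure"
      then have "\<exists>z. 0 < z \<and> z < h k \<and> F (?R (h k) x) - F (?R 0 x) = (h k - 0) * G (?R z x)"
        by (intro MVT2 h0 der) simp
      then obtain z where "F (?R (h k) x) - F x = h k * G (?R z x)" by (auto simp: R0)
      then have "s k x = G (?R z x)" using h0[of k] by (simp add: s_def)
      then show "norm (s k x) \<le> M" using M[OF RS] x by simp
    qed
  qed
  then have "(\<lambda>k. 0) \<longlonglongrightarrow> (LINT x|sphere_measure. G x)" by (simp only: s0)
  then show ?thesis by (simp add: G_def LIMSEQ_const_iff)
qed

text \<open>On the sphere \<open>b - (x \<bullet> b) *\<^sub>R x\<close> is the sum over \<open>c\<close> of \<open>x \<bullet> c\<close> times the rotation field in the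
  plane of \<open>c\<close> and \<open>b\<close>.\<close>

lemma integral_coord_flow:
  fixes b :: "'a::euclidean_space"
  assumes F: "C1_on_sphere F" and b: "b \<in> Basis"
  shows "(LINT x|sphere_measure. coord_flow b F x) =
    (real DIM('a) - 1) * (LINT x|sphere_measure. F x * (x \<bullet> b))"
proof -
  let ?w = "\<lambda>c x. (x \<bullet> c) *\<^sub>R b - (x \<bullet> b) *\<^sub>R c"
  let ?D = "\<lambda>x. frechet_derivative F (at x)"
  have cF: "continuous_on (sphere 0 1) F" by (rule C1_on_sphere_imp_continuous_on[OF F])
  have i1: "integrable sphere_measure (\<lambda>x. (x \<bullet> c) * ?D x (?w c x))" for c
    by (intro integrable_sphere_measure continuous_intros C1_on_sphere_continuous_on_derivative F)
  have i2: "integrable sphere_measure (\<lambda>x. F x * (x \<bullet> b))"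
    by (intro integrable_sphere_measure continuous_intros cF)
  \<comment> \<open>The rotation field \<open>?w c\<close> sends the coordinate
    \<open>x \<bullet> c\<close> to \<open>- (x \<bullet> b)\<close>. Hence the vanishing integral
    for the product of \<open>x \<bullet> c\<close> and \<open>F\<close> yields one copy of the
    right-hand side for each \<open>c\<close> other than \<open>b\<close>.\<close>
  have c: "(LINT x|sphere_measure. (x \<bullet> c) * ?D x (?w c x)) = (LINT x|sphere_measure. F x * (x \<bullet> b))"
    if "c \<in> Basis - {b}" for c
  proof -
    have "(LINT x|sphere_measure. frechet_derivative (\<lambda>x. (x \<bullet> c) * F x) (at x) (?w c x)) = 0"
      using that b by (intro integral_rotation_derivative_eq_0 C1_on_sphere_mult C1_on_sphere_inner F) auto
    also have "(LINT x|sphere_measure. frechet_derivative (\<lambda>x. (x \<bullet> c) * F x) (at x) (?w c x)) =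
      (LINT x|sphere_measure. (x \<bullet> c) * ?D x (?w c x) - F x * (x \<bullet> b))"
    proof (rule Bochner_Integration.integral_cong[OF refl])
      fix x :: 'a assume x: "x \<in> space sphere_measure"
      have "?w c x \<bullet> c = - (x \<bullet> b)" using that b by (auto simp: inner_diff_left inner_Basis)
      moreover have "frechet_derivative (\<lambda>x. (x \<bullet> c) * F x) (at x) (?w c x) =
        (x \<bullet> c) * ?D x (?w c x) + frechet_derivative (\<lambda>x. x \<bullet> c) (at x) (?w c x) * F x"
        using F C1_on_sphere_inner[of c] x unfolding C1_on_sphere_def by (intro frechet_derivative_mult) auto
      ultimately show "frechet_derivative (\<lambda>x. (x \<bullet> c) * F x) (at x) (?w c x) =
        (x \<bullet> c) * ?D x (?w c x) - F x * (x \<bullet> b)"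
        by (simp only: frechet_derivative_inner) simp
    qed
    finally show ?thesis using i1 i2 by simp
  qed
  have "(LINT x|sphere_measure. coord_flow b F x) =
      (LINT x|sphere_measure. (\<Sum>c\<in>Basis. (x \<bullet> c) * ?D x (?w c x)))"
  proof (rule Bochner_Integration.integral_cong[OF refl])
    fix x :: 'a assume x: "x \<in> space sphere_measure"
    then interpret D: linear "?D x"
      using C1_on_sphere_has_derivative[OF F] by (intro has_derivative_linear) simp
    have "(\<Sum>c\<in>Basis. (x \<bullet> c) * ?D x (?w c x)) = ?D x (\<Sum>c\<in>Basis. (x \<bullet> c) *\<^sub>R ?w c x)"
      by (simp add: D.sum D.scaleR)
    also have "(\<Sum>c\<in>Basis. (x \<bullet> c) *\<^sub>R ?w c x) = (\<Sum>c\<in>Basis. (x \<bullet> c) * (x \<bullet> c)) *\<^sub>R b - (x \<bullet> b) *\<^sub>R (\<Sum>c\<in>Basis. (x \<bullet> c) *\<^sub>R c)"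
      by (simp add: scaleR_right_diff_distrib sum_subtractf scaleR_sum_left scaleR_sum_right mult.commute)
    also have "\<dots> = b - (x \<bullet> b) *\<^sub>R x"
      using x by (simp add: euclidean_inner[symmetric] euclidean_representation power2_norm_eq_inner[symmetric])
    finally show "coord_flow b F x = (\<Sum>c\<in>Basis. (x \<bullet> c) * ?D x (?w c x))"
      by (simp add: coord_flow_def)
  qed
  also have "\<dots> = (\<Sum>c\<in>Basis. LINT x|sphere_measure. (x \<bullet> c) * ?D x (?w c x))"
    by (rule Bochner_Integration.integral_sum) (rule i1)
  also have "\<dots> = (LINT x|sphere_measure. (x \<bullet> b) * ?D x (?w b x)) +
      (\<Sum>c\<in>Basis - {b}. LINT x|sphere_measure. (x \<bullet> c) * ?D x (?w c x))"
    by (rule sum.remove) (use b in auto)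
  \<comment> \<open>For \<open>c = b\<close> the rotation field is zero, which leaves the dimension
    minus one terms.\<close>
  also have "(LINT x|sphere_measure. (x \<bullet> b) * ?D x (?w b x)) = (LINT x|(sphere_measure :: 'a measure). 0)"
  proof (rule Bochner_Integration.integral_cong[OF refl])
    fix x :: 'a assume x: "x \<in> space sphere_measure"
    then interpret D: linear "?D x"
      using C1_on_sphere_has_derivative[OF F] by (intro has_derivative_linear) simp
    show "(x \<bullet> b) * ?D x (?w b x) = 0" by (simp add: D.zero)
  qed
  also have "(\<Sum>c\<in>Basis - {b}. LINT x|sphere_measure. (x \<bullet> c) * ?D x (?w c x)) =
      (real DIM('a) - 1) * (LINT x|sphere_measure. F x * (x \<bullet> b))"
    using b by (simp add: c of_nat_diff Suc_leI)
  finally show ?thesis by simp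
qed

section \<open>Solid harmonics\<close>

definition dirderiv :: "'a::euclidean_space \<Rightarrow> ('a \<Rightarrow> real) \<Rightarrow> 'a \<Rightarrow> real" where
  "dirderiv b f x = frechet_derivative f (at x) b"

lemma laplacian_eq_dirderiv: "laplacian f x = (\<Sum>b\<in>Basis. dirderiv b (dirderiv b f) x)"
  by (simp add: laplacian_def dirderiv_def[abs_def])

lemma dirderivI: "(f has_derivative D) (at x) \<Longrightarrow> dirderiv b f x = D b"
  unfolding dirderiv_def by (drule frechet_derivative_at) simp

lemma has_derivative_polynomial:
  "real_polynomial_function f \<Longrightarrow> (f has_derivative frechet_derivative f (at x)) (at x)"
  using differentiable_at_real_polynomial_function frechet_derivative_works by blast

lemma dirderiv_const [simp]: "dirderiv b (\<lambda>x. c) = (\<lambda>x. 0)"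
  by (simp add: dirderiv_def fun_eq_iff)

lemma dirderiv_bounded_linear: "bounded_linear f \<Longrightarrow> dirderiv b f = (\<lambda>x. f b)"
  by (auto intro!: dirderivI bounded_linear_imp_has_derivative)

lemma dirderiv_add:
  assumes "real_polynomial_function f" "real_polynomial_function g"
  shows "dirderiv b (\<lambda>x. f x + g x) = (\<lambda>x. dirderiv b f x + dirderiv b g x)"
  using dirderivI[OF has_derivative_add[OF assms[THEN has_derivative_polynomial]]]
  by (auto simp: dirderiv_def)

lemma dirderiv_diff:
  assumes "real_polynomial_function f" "real_polynomial_function g"
  shows "dirderiv b (\<lambda>x. f x - g x) = (\<lambda>x. dirderiv b f x - dirderiv b g x)"
  using dirderivI[OF has_derivative_diff[OF assms[THEN has_derivative_polynomial]]]
  by (auto simp: dirderiv_def)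

lemma dirderiv_mult:
  assumes "real_polynomial_function f" "real_polynomial_function g"
  shows "dirderiv b (\<lambda>x. f x * g x) = (\<lambda>x. f x * dirderiv b g x + dirderiv b f x * g x)"
  using dirderivI[OF has_derivative_mult[OF assms[THEN has_derivative_polynomial]]]
  by (auto simp: dirderiv_def)

lemma dirderiv_cmult:
  assumes "real_polynomial_function f"
  shows "dirderiv b (\<lambda>x. c * f x) = (\<lambda>x. c * dirderiv b f x)"
  using dirderiv_mult[OF real_polynomial_function.intros(2) assms] by simp

lemma real_polynomial_function_dirderiv:
  "real_polynomial_function f \<Longrightarrow> real_polynomial_function (dirderiv b f)"
proof (induction rule: real_polynomial_function.induct)
  case (linear f)
  then show ?case by (simp add: dirderiv_bounded_linear real_polynomial_function.intros(2))
next
  case (const c)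
  then show ?case by (simp add: real_polynomial_function.intros(2))
next
  case (add f g)
  then show ?case by (auto simp: dirderiv_add)
next
  case (mult f g)
  then show ?case by (auto simp: dirderiv_mult)
qed

text \<open>Induction on the construction of the polynomial: second derivatives of linear functions
  and constants vanish, and the twice applied product rule is symmetric in \<open>b\<close> and
  \<open>c\<close>.\<close>

lemma dirderiv_commute:
  "real_polynomial_function f \<Longrightarrow> dirderiv b (dirderiv c f) = dirderiv c (dirderiv b f)"
proof (induction rule: real_polynomial_function.induct)
  case (linear f)
  then show ?case by (simp add: dirderiv_bounded_linear)
next
  case (const c)
  then show ?case by simp
next
  case (add f g)
  then show ?case by (simp add: dirderiv_add real_polynomial_function_dirderiv)
next
  case (mult f g)
  then show ?case
    by (simp add: dirderiv_add dirderiv_mult real_polynomial_function_dirderiv real_polynomial_function.intros(4))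
      (simp add: fun_eq_iff)
qed

lemma real_polynomial_function_inner: "real_polynomial_function (\<lambda>x. x \<bullet> c)"
  by (rule real_polynomial_function.intros(1)) (rule bounded_linear_inner_left)

lemma real_polynomial_function_inner_self: "real_polynomial_function (\<lambda>x::'a::euclidean_space. x \<bullet> x)"
  unfolding euclidean_inner[of x x for x]
  by (intro real_polynomial_function_sum real_polynomial_function.intros(4) real_polynomial_function_inner) simp

lemma dirderiv_inner: "dirderiv b (\<lambda>x. x \<bullet> c) = (\<lambda>x. b \<bullet> c)"
  by (rule dirderiv_bounded_linear) (rule bounded_linear_inner_left)

lemma dirderiv_inner_self: "dirderiv b (\<lambda>x. x \<bullet> x) = (\<lambda>x. 2 * (x \<bullet> b))"
proof
  fix x :: 'a
  have "((\<lambda>x. x \<bullet> x) has_derivative (\<lambda>h. x \<bullet> h + h \<bullet> x)) (at x)"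
    by (intro has_derivative_inner has_derivative_ident)
  from dirderivI[OF this] show "dirderiv b (\<lambda>x. x \<bullet> x) x = 2 * (x \<bullet> b)" by (simp add: inner_commute)
qed

lemmas real_polynomial_function_rules =
  real_polynomial_function.intros(2) real_polynomial_function.intros(3) real_polynomial_function.intros(4)
  real_polynomial_function_diff real_polynomial_function_dirderiv
  real_polynomial_function_inner real_polynomial_function_inner_self

lemma frechet_derivative_polynomial_sum:
  assumes "real_polynomial_function f"
  shows "frechet_derivative f (at x) v = (\<Sum>c\<in>Basis. (v \<bullet> c) * dirderiv c f x)"
proof -
  interpret D: linear "frechet_derivative f (at x)"
    by (rule has_derivative_linear[OF has_derivative_polynomial[OF assms]])
  have "frechet_derivative f (at x) v = frechet_derivative f (at x) (\<Sum>c\<in>Basis. (v \<bullet> c) *\<^sub>R c)"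
    by (simp add: euclidean_representation)
  then show ?thesis by (simp add: D.sum D.scaleR dirderiv_def)
qed

section \<open>Homogeneous functions and Euler's identity\<close>

definition homogeneous :: "nat \<Rightarrow> ('a::real_vector \<Rightarrow> real) \<Rightarrow> bool" where
  "homogeneous k f \<longleftrightarrow> (\<forall>t>0. \<forall>x. f (t *\<^sub>R x) = t ^ k * f x)"

lemma homogeneous_mult: "homogeneous j f \<Longrightarrow> homogeneous k g \<Longrightarrow> homogeneous (j + k) (\<lambda>x. f x * g x)"
  by (simp add: homogeneous_def power_add algebra_simps)

lemma homogeneous_cmult: "homogeneous k f \<Longrightarrow> homogeneous k (\<lambda>x. c * f x)"
  by (simp add: homogeneous_def)

lemma homogeneous_add: "homogeneous k f \<Longrightarrow> homogeneous k g \<Longrightarrow> homogeneous k (\<lambda>x. f x + g x)"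
  by (simp add: homogeneous_def algebra_simps)

lemma homogeneous_diff: "homogeneous k f \<Longrightarrow> homogeneous k g \<Longrightarrow> homogeneous k (\<lambda>x. f x - g x)"
  by (simp add: homogeneous_def algebra_simps)

lemma homogeneous_inner: "homogeneous 1 (\<lambda>x. x \<bullet> b)"
  by (simp add: homogeneous_def)

lemma homogeneous_inner_self: "homogeneous 2 (\<lambda>x. x \<bullet> x)"
  by (simp add: homogeneous_def power2_eq_square)

lemma homogeneous_zero: "homogeneous k (\<lambda>x. 0)"
  by (simp add: homogeneous_def)

text \<open>Both sides are the derivative of \<open>f (t *\<^sub>R x)\<close> with respect to
  \<open>t\<close> at \<open>t = 1\<close>.\<close>

lemma euler_homogeneous:
  assumes f: "real_polynomial_function f" and h: "homogeneous k f"
  shows "frechet_derivative f (at x) x = real k * f x"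
proof -
  have 1: "((\<lambda>t. t *\<^sub>R x) has_derivative (\<lambda>t. t *\<^sub>R x)) (at (1::real))"
    by (auto intro!: derivative_eq_intros)
  have 2: "(f has_derivative frechet_derivative f (at x)) (at (1 *\<^sub>R x))"
    using has_derivative_polynomial[OF f] by simp
  have "((\<lambda>t. f (t *\<^sub>R x)) has_derivative (\<lambda>t. frechet_derivative f (at x) (t *\<^sub>R x))) (at 1)"
    by (rule has_derivative_compose[OF 1 2])
  moreover have "((\<lambda>t. f (t *\<^sub>R x)) has_derivative (\<lambda>t. t * (real k * f x))) (at 1)"
  proof (rule has_derivative_transform_within_open)
    show "((\<lambda>t. t ^ k * f x) has_derivative (\<lambda>t. t * (real k * f x))) (at 1)"
      by (auto intro!: derivative_eq_intros)
    show "open {0::real<..}" "1 \<in> {0::real<..}" by auto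
    show "\<And>t. t \<in> {0<..} \<Longrightarrow> t ^ k * f x = f (t *\<^sub>R x)"
      using h by (simp add: homogeneous_def)
  qed
  ultimately have "(\<lambda>t. frechet_derivative f (at x) (t *\<^sub>R x)) = (\<lambda>t. t * (real k * f x))"
    by (rule has_derivative_unique)
  from fun_cong[OF this, of 1] show ?thesis by simp
qed

lemma euler_homogeneous_sum:
  assumes "real_polynomial_function f" "homogeneous k f"
  shows "(\<Sum>c\<in>Basis. (x \<bullet> c) * dirderiv c f x) = real k * f x"
  using assms euler_homogeneous frechet_derivative_polynomial_sum by metis

text \<open>Homogeneity concerns positive factors only, so it makes \<open>f\<close> constant on
  open rays; continuity at the origin joins them.\<close>

lemma homogeneous_0_polynomial:
  assumes f: "real_polynomial_function f" and h: "homogeneous 0 f"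
  shows "f x = f 0"
proof (rule tendsto_unique)
  show "at_right (0::real) \<noteq> bot" by simp
  have c: "continuous (at 0) f"
    using has_derivative_polynomial[OF f] has_derivative_continuous by blast
  have "((\<lambda>t. t *\<^sub>R x) \<longlongrightarrow> 0) (at_right 0)"
    by (rule tendsto_eq_intros tendsto_ident_at refl | simp)+
  from isCont_tendsto_compose[OF c this] show "((\<lambda>t. f (t *\<^sub>R x)) \<longlongrightarrow> f 0) (at_right 0)" .
  have "eventually (\<lambda>t. f x = f (t *\<^sub>R x)) (at_right (0::real))"
    using eventually_at_right_less[of "0::real"] by eventually_elim (use h in \<open>simp add: homogeneous_def\<close>)
  then show "((\<lambda>t. f (t *\<^sub>R x)) \<longlongrightarrow> f x) (at_right 0)"
    by (rule Lim_transform_eventually[OF tendsto_const])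
qed

lemma dirderiv_homogeneous_0:
  assumes "real_polynomial_function f" "homogeneous 0 f"
  shows "dirderiv b f = (\<lambda>x. 0)"
proof -
  have "f = (\<lambda>x. f 0)" using homogeneous_0_polynomial[OF assms] by auto
  then show ?thesis by (metis dirderiv_const)
qed

text \<open>Differentiate \<open>f (t *\<^sub>R x) = t ^ Suc k * f x\<close> in \<open>x\<close>
  along \<open>b\<close> and cancel one factor \<open>t\<close>.\<close>

lemma homogeneous_dirderiv:
  assumes f: "real_polynomial_function f" and h: "homogeneous (Suc k) f"
  shows "homogeneous k (dirderiv b f)"
  unfolding homogeneous_def
proof (intro allI impI)
  fix t :: real and x :: 'a assume t: "t > 0"
  have "((\<lambda>x. f (t *\<^sub>R x)) has_derivative (\<lambda>v. frechet_derivative f (at (t *\<^sub>R x)) (t *\<^sub>R v))) (at x)"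
    by (rule has_derivative_compose[OF _ has_derivative_polynomial[OF f]]) (auto intro!: derivative_eq_intros)
  moreover have "(\<lambda>x. f (t *\<^sub>R x)) = (\<lambda>x. t ^ Suc k * f x)"
    using h t by (simp add: homogeneous_def)
  ultimately have "dirderiv b (\<lambda>x. t ^ Suc k * f x) x = frechet_derivative f (at (t *\<^sub>R x)) (t *\<^sub>R b)"
    by (metis dirderivI)
  also have "\<dots> = t * dirderiv b f (t *\<^sub>R x)"
    using linear_scale[OF has_derivative_linear[OF has_derivative_polynomial[OF f]]] by (simp add: dirderiv_def)
  finally have "t ^ Suc k * dirderiv b f x = t * dirderiv b f (t *\<^sub>R x)"
    by (simp only: dirderiv_cmult[OF f])
  then have "t * (t ^ k * dirderiv b f x) = t * dirderiv b f (t *\<^sub>R x)" by (simp only: power_Suc mult.assoc)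
  then show "dirderiv b f (t *\<^sub>R x) = t ^ k * dirderiv b f x" using t by (metis mult_left_cancel less_irrefl)
qed

section \<open>The Euclidean Laplacian on polynomials\<close>

lemma laplacian_mult:
  assumes f: "real_polynomial_function f" and g: "real_polynomial_function g"
  shows "laplacian (\<lambda>x. f x * g x) x =
    f x * laplacian g x + 2 * (\<Sum>c\<in>Basis. dirderiv c f x * dirderiv c g x) + laplacian f x * g x"
  using assms unfolding laplacian_eq_dirderiv
  by (simp add: dirderiv_add dirderiv_mult real_polynomial_function_rules algebra_simps
      sum.distrib sum_distrib_left sum_distrib_right)

lemma laplacian_add:
  assumes "real_polynomial_function f" "real_polynomial_function g"
  shows "laplacian (\<lambda>x. f x + g x) x = laplacian f x + laplacian g x"
  using assms unfolding laplacian_eq_dirderiv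
  by (simp add: dirderiv_add real_polynomial_function_rules sum.distrib)

lemma laplacian_diff:
  assumes "real_polynomial_function f" "real_polynomial_function g"
  shows "laplacian (\<lambda>x. f x - g x) x = laplacian f x - laplacian g x"
  using assms unfolding laplacian_eq_dirderiv
  by (simp add: dirderiv_diff real_polynomial_function_rules sum_subtractf)

lemma laplacian_cmult:
  assumes "real_polynomial_function f"
  shows "laplacian (\<lambda>x. c * f x) x = c * laplacian f x"
  using assms unfolding laplacian_eq_dirderiv
  by (simp add: dirderiv_cmult real_polynomial_function_rules sum_distrib_left)

lemma laplacian_inner: "laplacian (\<lambda>x. x \<bullet> b) x = 0"
  by (simp add: laplacian_eq_dirderiv dirderiv_inner)

lemma laplacian_inner_self: "laplacian (\<lambda>x::'a::euclidean_space. x \<bullet> x) x = 2 * real DIM('a)"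
  by (simp add: laplacian_eq_dirderiv dirderiv_inner_self dirderiv_cmult real_polynomial_function_inner dirderiv_inner inner_Basis)

lemma laplacian_dirderiv:
  assumes f: "real_polynomial_function f"
  shows "laplacian (dirderiv b f) x = dirderiv b (laplacian f) x"
proof -
  have s: "dirderiv b (\<lambda>x. \<Sum>c\<in>B. dirderiv c (dirderiv c f) x) x = (\<Sum>c\<in>B. dirderiv b (dirderiv c (dirderiv c f)) x)"
    if "finite B" for B :: "'a set"
    using that f by (induction B) (simp_all add: dirderiv_add real_polynomial_function_rules real_polynomial_function_sum)
  have "dirderiv c (dirderiv c (dirderiv b f)) = dirderiv b (dirderiv c (dirderiv c f))" for c
    using f by (metis dirderiv_commute real_polynomial_function_dirderiv)
  then show ?thesis
    unfolding laplacian_eq_dirderiv[abs_def] by (simp add: s)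
qed

section \<open>Harmonic polynomials and their products with a coordinate\<close>

definition solid_harmonic :: "nat \<Rightarrow> ('a::euclidean_space \<Rightarrow> real) \<Rightarrow> bool" where
  "solid_harmonic k Y \<longleftrightarrow> real_polynomial_function Y \<and> homogeneous k Y \<and> (\<forall>x. laplacian Y x = 0)"

lemma solid_harmonic_zero: "solid_harmonic k (\<lambda>x. 0)"
  by (auto simp: solid_harmonic_def homogeneous_zero laplacian_eq_dirderiv)

lemma solid_harmonic_const: "solid_harmonic 0 (\<lambda>x. c)"
  by (auto simp: solid_harmonic_def homogeneous_def laplacian_eq_dirderiv)

lemma solid_harmonic_inner: "solid_harmonic 1 (\<lambda>x. x \<bullet> b)"
  unfolding solid_harmonic_def
  by (auto simp: real_polynomial_function_inner homogeneous_inner laplacian_inner simp del: One_nat_def)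

lemma solid_harmonic_add:
  "solid_harmonic k Y \<Longrightarrow> solid_harmonic k Z \<Longrightarrow> solid_harmonic k (\<lambda>x. Y x + Z x)"
  by (auto simp: solid_harmonic_def homogeneous_add laplacian_add)

lemma solid_harmonic_cmult:
  "solid_harmonic k Y \<Longrightarrow> solid_harmonic k (\<lambda>x. c * Y x)"
  by (auto simp: solid_harmonic_def homogeneous_cmult laplacian_cmult)

lemma solid_harmonic_dirderiv:
  assumes "solid_harmonic (Suc k) Y"
  shows "solid_harmonic k (dirderiv b Y)"
proof -
  have "laplacian Y = (\<lambda>x. 0)" using assms by (auto simp: solid_harmonic_def)
  then show ?thesis
    using assms by (auto simp: solid_harmonic_def homogeneous_dirderiv laplacian_dirderiv real_polynomial_function_rules)
qed

lemma dirderiv_solid_harmonic_0: "solid_harmonic 0 Y \<Longrightarrow> dirderiv b Y = (\<lambda>x. 0)"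
  by (simp add: solid_harmonic_def dirderiv_homogeneous_0)

text \<open>The components of degree \<open>k - 1\<close> and \<open>k + 1\<close> of \<open>(x \<bullet> b) * Y x\<close> on the sphere, for \<open>Y\<close>
  harmonic of degree \<open>k\<close>. The former vanishes for \<open>k = 0\<close>.\<close>

definition harmonic_down :: "nat \<Rightarrow> 'a::euclidean_space \<Rightarrow> ('a \<Rightarrow> real) \<Rightarrow> 'a \<Rightarrow> real" where
  "harmonic_down k b Y x = 1 / (2 * real k + real DIM('a) - 2) * dirderiv b Y x"

definition harmonic_up :: "nat \<Rightarrow> 'a::euclidean_space \<Rightarrow> ('a \<Rightarrow> real) \<Rightarrow> 'a \<Rightarrow> real" where
  "harmonic_up k b Y x = (x \<bullet> b) * Y x - (x \<bullet> x) * harmonic_down k b Y x"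

lemma solid_harmonic_down: "solid_harmonic (Suc k) Y \<Longrightarrow> solid_harmonic k (harmonic_down (Suc k) b Y)"
  unfolding harmonic_down_def[abs_def] by (intro solid_harmonic_cmult solid_harmonic_dirderiv)

lemma harmonic_down_0: "solid_harmonic 0 Y \<Longrightarrow> harmonic_down 0 b Y = (\<lambda>x. 0)"
  unfolding harmonic_down_def[abs_def] by (simp add: dirderiv_solid_harmonic_0)

lemma harmonic_up_down: "x \<in> sphere 0 1 \<Longrightarrow> (x \<bullet> b) * Y x = harmonic_up k b Y x + harmonic_down k b Y x"
  by (simp add: harmonic_up_def norm_eq_1)

text \<open>The coefficient in \<open>harmonic_down\<close> is chosen for this. The product of
  \<open>x \<bullet> b\<close> and \<open>Y x\<close> has Laplacian
  \<open>2 * dirderiv b Y x\<close>. For \<open>W\<close> harmonic of degree \<open>k - 1\<close>,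
  the product of \<open>x \<bullet> x\<close> and \<open>W x\<close> has Laplacian
  \<open>2 * (2 * real k + real DIM('a) - 2) * W x\<close>, by Euler's identity. So the two
  Laplacians cancel.\<close>

lemma solid_harmonic_up:
  fixes Y :: "'a::euclidean_space \<Rightarrow> real"
  assumes Y: "solid_harmonic k Y" and b: "b \<in> Basis" and D: "DIM('a) > 2"
  shows "solid_harmonic (Suc k) (harmonic_up k b Y)"
proof -
  let ?W = "harmonic_down k b Y"
  have pY: "real_polynomial_function Y" and hY: "homogeneous k Y" and lY: "laplacian Y x = 0" for x
    using Y by (auto simp: solid_harmonic_def)
  have pW: "real_polynomial_function ?W"
    unfolding harmonic_down_def[abs_def] using pY by (intro real_polynomial_function_rules)
  have l1: "laplacian (\<lambda>x. (x \<bullet> b) * Y x) x = 2 * dirderiv b Y x" for x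
  proof -
    have "(\<Sum>c\<in>Basis. (c \<bullet> b) * dirderiv c Y x) = (\<Sum>c\<in>Basis. if c = b then dirderiv c Y x else 0)"
      using b by (intro sum.cong) (auto simp: inner_Basis)
    then show ?thesis
      using b by (simp add: laplacian_mult real_polynomial_function_inner pY lY laplacian_inner dirderiv_inner)
  qed
  have W: "laplacian (\<lambda>x. (x \<bullet> x) * ?W x) x = 2 * dirderiv b Y x \<and>
      homogeneous (Suc k) (\<lambda>x. (x \<bullet> x) * ?W x)" for x
  proof (cases k)
    \<comment> \<open>In degree 0 there is no lower component, and all the terms vanish.\<close>
    case 0
    then show ?thesis using Y
      by (simp add: harmonic_down_0 dirderiv_solid_harmonic_0 homogeneous_zero laplacian_eq_dirderiv)
  next
    case (Suc j)
    then have W: "solid_harmonic j ?W" using Y by (simp add: solid_harmonic_down)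
    have "(\<Sum>c\<in>Basis. 2 * (x \<bullet> c) * dirderiv c ?W x) = 2 * (real j * ?W x)"
      using W by (simp add: euler_homogeneous_sum[symmetric] solid_harmonic_def sum_distrib_left mult.assoc)
    then have "laplacian (\<lambda>x. (x \<bullet> x) * ?W x) x = (4 * real j + 2 * real DIM('a)) * ?W x"
      using W by (simp add: laplacian_mult real_polynomial_function_inner_self pW laplacian_inner_self
          dirderiv_inner_self solid_harmonic_def algebra_simps)
    also have "\<dots> = 2 * dirderiv b Y x"
      using D by (simp add: harmonic_down_def Suc field_simps)
    finally show ?thesis
      using homogeneous_mult[OF homogeneous_inner_self, of j ?W] W
      by (simp add: Suc solid_harmonic_def numeral_2_eq_2)
  qed
  show ?thesis
    unfolding solid_harmonic_def harmonic_up_def[abs_def]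
    using W l1 homogeneous_mult[OF homogeneous_inner hY, of b]
    by (auto intro!: homogeneous_diff real_polynomial_function_rules pY pW
        simp: laplacian_diff real_polynomial_function_rules pY pW)
qed

section \<open>Polynomials on the sphere as finite sums of harmonics\<close>

definition harmonic_sum_on_sphere :: "('a::euclidean_space \<Rightarrow> real) \<Rightarrow> bool" where
  "harmonic_sum_on_sphere f \<longleftrightarrow> (\<exists>N Q. (\<forall>k. solid_harmonic k (Q k)) \<and> (\<forall>k>N. Q k = (\<lambda>x. 0)) \<and>
     (\<forall>x\<in>sphere 0 1. f x = (\<Sum>k\<le>N. Q k x)))"

lemma harmonic_sum_on_sphere_cong:
  "harmonic_sum_on_sphere f \<Longrightarrow> (\<And>x. x \<in> sphere 0 1 \<Longrightarrow> f x = g x) \<Longrightarrow> harmonic_sum_on_sphere g"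
  unfolding harmonic_sum_on_sphere_def by metis

lemma harmonic_sum_on_sphere_solid:
  assumes "solid_harmonic k Y"
  shows "harmonic_sum_on_sphere Y"
  unfolding harmonic_sum_on_sphere_def
proof (intro exI[of _ k] exI[of _ "\<lambda>j. if j = k then Y else (\<lambda>x. 0)"] conjI allI impI ballI)
  show "Y x = (\<Sum>j\<le>k. (if j = k then Y else (\<lambda>x. 0)) x)" for x
    by (simp add: if_distrib[of "\<lambda>f. f x"])
qed (use assms in \<open>auto simp: solid_harmonic_zero\<close>)

text \<open>Each family vanishes beyond its bound, so both sums can be padded to the larger length
  and added degree by degree.\<close>

lemma harmonic_sum_on_sphere_add:
  assumes "harmonic_sum_on_sphere f" "harmonic_sum_on_sphere g"
  shows "harmonic_sum_on_sphere (\<lambda>x. f x + g x)"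
proof -
  obtain N Q where Q: "\<And>k. solid_harmonic k (Q k)" "\<And>k. k > N \<Longrightarrow> Q k = (\<lambda>x. 0)"
      "\<And>x. x \<in> sphere 0 1 \<Longrightarrow> f x = (\<Sum>k\<le>N. Q k x)"
    using assms(1) unfolding harmonic_sum_on_sphere_def by metis
  obtain M P where P: "\<And>k. solid_harmonic k (P k)" "\<And>k. k > M \<Longrightarrow> P k = (\<lambda>x. 0)"
      "\<And>x. x \<in> sphere 0 1 \<Longrightarrow> g x = (\<Sum>k\<le>M. P k x)"
    using assms(2) unfolding harmonic_sum_on_sphere_def by metis
  let ?K = "max N M"
  have "k \<le> N" if "Q k x \<noteq> 0" for k x using Q(2)[of k] that by (metis not_le)
  moreover have "k \<le> M" if "P k x \<noteq> 0" for k x using P(2)[of k] that by (metis not_le)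
  ultimately have "(\<Sum>k\<le>N. Q k x) = (\<Sum>k\<le>?K. Q k x)" "(\<Sum>k\<le>M. P k x) = (\<Sum>k\<le>?K. P k x)" for x
    by (auto intro!: sum.mono_neutral_left)
  then show ?thesis
    unfolding harmonic_sum_on_sphere_def
    by (intro exI[of _ ?K] exI[of _ "\<lambda>k x. Q k x + P k x"])
      (simp add: Q P solid_harmonic_add sum.distrib)
qed

lemma harmonic_sum_on_sphere_sum:
  "finite I \<Longrightarrow> (\<And>i. i \<in> I \<Longrightarrow> harmonic_sum_on_sphere (f i)) \<Longrightarrow>
    harmonic_sum_on_sphere (\<lambda>x. \<Sum>i\<in>I. f i x)"
  by (induction I rule: finite_induct)
    (simp_all add: harmonic_sum_on_sphere_add harmonic_sum_on_sphere_solid[OF solid_harmonic_zero])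

lemma harmonic_sum_on_sphere_cmult:
  assumes "harmonic_sum_on_sphere f"
  shows "harmonic_sum_on_sphere (\<lambda>x. c * f x)"
proof -
  obtain N Q where Q: "\<And>k. solid_harmonic k (Q k)" "\<And>k. k > N \<Longrightarrow> Q k = (\<lambda>x. 0)"
      "\<And>x. x \<in> sphere 0 1 \<Longrightarrow> f x = (\<Sum>k\<le>N. Q k x)"
    using assms unfolding harmonic_sum_on_sphere_def by metis
  have "harmonic_sum_on_sphere (\<lambda>x. \<Sum>k\<le>N. c * Q k x)"
    by (intro harmonic_sum_on_sphere_sum harmonic_sum_on_sphere_solid[OF solid_harmonic_cmult[OF Q(1)]]) simp
  then show ?thesis
    by (rule harmonic_sum_on_sphere_cong) (simp add: Q(3) sum_distrib_left)
qed

text \<open>On the sphere a coordinate times a component of degree \<open>k\<close> splits into its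
  raised and lowered parts, both harmonic.\<close>

lemma harmonic_sum_on_sphere_inner_mult:
  fixes f :: "'a::euclidean_space \<Rightarrow> real"
  assumes f: "harmonic_sum_on_sphere f" and b: "b \<in> Basis" and D: "DIM('a) > 2"
  shows "harmonic_sum_on_sphere (\<lambda>x. (x \<bullet> b) * f x)"
proof -
  obtain N Q where Q: "\<And>k. solid_harmonic k (Q k)" "\<And>k. k > N \<Longrightarrow> Q k = (\<lambda>x. 0)"
      "\<And>x. x \<in> sphere 0 1 \<Longrightarrow> f x = (\<Sum>k\<le>N. Q k x)"
    using f unfolding harmonic_sum_on_sphere_def by metis
  have down: "harmonic_sum_on_sphere (harmonic_down k b (Q k))" for k
  proof (cases k)
    case 0
    then show ?thesis using harmonic_down_0[OF Q(1)[of 0]] harmonic_sum_on_sphere_solid[OF solid_harmonic_zero] by simp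
  next
    case (Suc j)
    then show ?thesis using harmonic_sum_on_sphere_solid[OF solid_harmonic_down[OF Q(1)[of "Suc j"]]] by simp
  qed
  have "harmonic_sum_on_sphere (\<lambda>x. \<Sum>k\<le>N. harmonic_up k b (Q k) x + harmonic_down k b (Q k) x)"
    by (intro harmonic_sum_on_sphere_sum harmonic_sum_on_sphere_add down
        harmonic_sum_on_sphere_solid[OF solid_harmonic_up[OF Q(1) b D]]) simp
  then show ?thesis
    by (rule harmonic_sum_on_sphere_cong) (simp add: harmonic_up_down[symmetric] Q(3) sum_distrib_left)
qed

text \<open>A linear \<open>p\<close> is a combination of coordinates. Generalizing over
  \<open>f\<close> lets a product of polynomials act one factor after the other.\<close>

lemma harmonic_sum_on_sphere_polynomial_mult:
  fixes p f :: "'a::euclidean_space \<Rightarrow> real"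
  assumes p: "real_polynomial_function p" and f: "harmonic_sum_on_sphere f" and D: "DIM('a) > 2"
  shows "harmonic_sum_on_sphere (\<lambda>x. p x * f x)"
  using p f
proof (induction arbitrary: f rule: real_polynomial_function.induct)
  case (linear p)
  have "harmonic_sum_on_sphere (\<lambda>x. \<Sum>b\<in>Basis. p b * ((x \<bullet> b) * f x))"
    by (intro harmonic_sum_on_sphere_sum harmonic_sum_on_sphere_cmult harmonic_sum_on_sphere_inner_mult linear D) auto
  moreover have "(\<Sum>b\<in>Basis. p b * ((x \<bullet> b) * f x)) = p x * f x" for x
  proof -
    interpret bounded_linear p by fact
    have "p x = p (\<Sum>b\<in>Basis. (x \<bullet> b) *\<^sub>R b)" by (simp add: euclidean_representation)
    also have "\<dots> = (\<Sum>b\<in>Basis. (x \<bullet> b) * p b)" by (simp add: sum scaleR)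
    finally show ?thesis by (simp add: sum_distrib_left algebra_simps)
  qed
  ultimately show ?case by simp
next
  case (const c)
  then show ?case by (rule harmonic_sum_on_sphere_cmult)
next
  case (add p q)
  then show ?case using harmonic_sum_on_sphere_add[OF add.IH(1)[OF add.prems] add.IH(2)[OF add.prems]]
    by (simp add: distrib_right)
next
  case (mult p q)
  then show ?case by (simp add: mult.assoc)
qed

text \<open>The constant 1 is harmonic of degree 0; multiply it by \<open>p\<close>.\<close>

lemma polynomial_harmonic_decomposition:
  fixes p :: "'a::euclidean_space \<Rightarrow> real"
  assumes "real_polynomial_function p" "DIM('a) > 2"
  shows "harmonic_sum_on_sphere p"
  using harmonic_sum_on_sphere_polynomial_mult[OF assms(1) harmonic_sum_on_sphere_solid[OF solid_harmonic_const[of 1]] assms(2)]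
  by simp

section \<open>Spherical harmonics as eigenfunctions\<close>

lemma C_k_on_polynomial: "real_polynomial_function f \<Longrightarrow> C_k_on k S f"
proof (induction k arbitrary: f)
  case 0
  then show ?case
    by (auto intro: continuous_on_polymonial_function simp: real_polynomial_function_eq)
next
  case (Suc k)
  then show ?case
    using real_polynomial_function_dirderiv
    by (auto simp: dirderiv_def[abs_def] intro: differentiable_at_real_polynomial_function)
qed

lemma smooth_on_sphere_polynomial: "real_polynomial_function f \<Longrightarrow> smooth_on_sphere f"
  unfolding smooth_on_sphere_def smooth_on_def
  by (intro exI[of _ UNIV] exI[of _ f]) (auto intro: C_k_on_polynomial)

lemma C1_on_sphere_polynomial: "real_polynomial_function f \<Longrightarrow> C1_on_sphere f"
  using C_k_on_polynomial[of f "Suc 0" "sphere 0 1"] unfolding C1_on_sphere_def by simp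

lemma continuous_on_polynomial: "real_polynomial_function f \<Longrightarrow> continuous_on S f"
  by (auto intro: continuous_on_polymonial_function simp: real_polynomial_function_eq)

text \<open>Functions of this shape arise because \<open>Y (sgn y) = Y y / norm y ^ k\<close> for
  homogeneous \<open>Y\<close>. Their directional derivatives are combinations of the same shape, so
  the rule serves for the second derivatives too.\<close>

lemma has_derivative_divide_norm_power:
  assumes f: "real_polynomial_function f" and y: "y \<noteq> 0"
  shows "((\<lambda>y. f y / norm y ^ k) has_derivative
    (\<lambda>v. frechet_derivative f (at y) v / norm y ^ k - real k * (y \<bullet> v) * f y / norm y ^ (k + 2))) (at y)"
proof -
  have n: "((\<lambda>y. norm y) has_derivative (\<lambda>v. y \<bullet> v / norm y)) (at y)"
    using has_derivative_norm[OF y] by (simp add: sgn_div_norm inner_commute divide_inverse mult.commute)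
  show ?thesis
    by (rule has_derivative_eq_rhs, rule has_derivative_divide[OF has_derivative_polynomial[OF f] has_derivative_power[OF n]])
      (use y in \<open>auto simp: fun_eq_iff field_simps power2_eq_square power_add power_diff\<close>)
qed

text \<open>Differentiate \<open>Y y / norm y ^ k\<close> twice and set the norm to 1. As
  \<open>Y\<close> is harmonic, Euler's identity leaves \<open>Y x\<close> with the factor
  \<open>- 2 * k\<^sup>2 - k * DIM('a) + k * (k + 2)\<close>, which is minus the stated
  eigenvalue.\<close>

lemma laplace_eigenfunction_solid_harmonic:
  fixes Y :: "'a::euclidean_space \<Rightarrow> real"
  assumes Y: "solid_harmonic k Y"
  shows "laplace_eigenfunction (real k * (real k + real DIM('a) - 2)) Y"
proof -
  have p: "real_polynomial_function Y" and h: "homogeneous k Y" and l: "laplacian Y x = 0" for x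
    using Y by (auto simp: solid_harmonic_def)
  have sgn: "Y (sgn y) = Y y / norm y ^ k" if "y \<noteq> 0" for y
    using h that by (simp add: homogeneous_def sgn_div_norm divide_inverse power_inverse)
  \<comment> \<open>The formulas hold only away from the origin, but a derivative at
    \<open>x\<close> sees only a neighbourhood of \<open>x\<close>.\<close>
  have loc: "dirderiv b F x = dirderiv b G x" if "\<And>y. y \<noteq> 0 \<Longrightarrow> F y = G y" "x \<noteq> 0" "(G has_derivative D) (at x)"
    for F G :: "'a \<Rightarrow> real" and b x D
  proof -
    have "(F has_derivative D) (at x)"
      by (rule has_derivative_transform_within_open[OF that(3), of "- {0}"]) (use that in auto)
    with that(3) show ?thesis by (simp add: dirderivI)
  qed
  have d1: "dirderiv b (\<lambda>y. Y (sgn y)) y = dirderiv b Y y / norm y ^ k - real k * ((y \<bullet> b) * Y y / norm y ^ (k + 2))"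
    if "y \<noteq> 0" for y b
    using loc[OF sgn that has_derivative_divide_norm_power[OF p that]] dirderivI[OF has_derivative_divide_norm_power[OF p that]]
    by (simp add: dirderiv_def mult.assoc)
  have d2: "dirderiv b (dirderiv b (\<lambda>y. Y (sgn y))) x =
      dirderiv b (dirderiv b Y) x - 2 * real k * ((x \<bullet> b) * dirderiv b Y x) - real k * Y x + real k * (real k + 2) * (x \<bullet> b)\<^sup>2 * Y x"
    if x: "x \<in> sphere 0 1" and b: "b \<in> Basis" for x b
  proof -
    have x0: "x \<noteq> 0" using x by auto
    let ?q = "\<lambda>y. (y \<bullet> b) * Y y"
    have pb: "real_polynomial_function (dirderiv b Y)" and pq: "real_polynomial_function ?q"
      by (intro real_polynomial_function_rules p)+
    have D: "((\<lambda>y. dirderiv b Y y / norm y ^ k - real k * (?q y / norm y ^ (k + 2))) has_derivative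
      (\<lambda>v. (frechet_derivative (dirderiv b Y) (at x) v / norm x ^ k - real k * (x \<bullet> v) * dirderiv b Y x / norm x ^ (k + 2)) -
       real k * (frechet_derivative ?q (at x) v / norm x ^ (k + 2) - real (k + 2) * (x \<bullet> v) * ?q x / norm x ^ (k + 2 + 2)))) (at x)"
      by (intro has_derivative_diff has_derivative_mult_right has_derivative_divide_norm_power pb pq x0)
    have q: "frechet_derivative ?q (at x) b = (x \<bullet> b) * dirderiv b Y x + Y x"
      using dirderiv_mult[OF real_polynomial_function_inner p, of b b] b
      by (simp add: dirderiv_inner dirderiv_def fun_eq_iff)
    have dd: "frechet_derivative (dirderiv b Y) (at x) b = dirderiv b (dirderiv b Y) x"
      by (simp only: dirderiv_def)
    have "dirderiv b (dirderiv b (\<lambda>y. Y (sgn y))) x =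
        dirderiv b (\<lambda>y. dirderiv b Y y / norm y ^ k - real k * (?q y / norm y ^ (k + 2))) x"
      by (rule loc[OF d1 x0 D])
    also have "\<dots> = (dirderiv b (dirderiv b Y) x / norm x ^ k - real k * (x \<bullet> b) * dirderiv b Y x / norm x ^ (k + 2)) -
       real k * (((x \<bullet> b) * dirderiv b Y x + Y x) / norm x ^ (k + 2) - real (k + 2) * (x \<bullet> b) * ?q x / norm x ^ (k + 2 + 2))"
      unfolding dirderivI[OF D] q dd ..
    finally show ?thesis
      using x by (simp add: algebra_simps power2_eq_square)
  qed
  have "- laplace_beltrami Y x = real k * (real k + real DIM('a) - 2) * Y x" if x: "x \<in> sphere 0 1" for x
  proof -
    have "(\<Sum>b\<in>Basis. (x \<bullet> b)\<^sup>2) = 1"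
      using x by (simp add: power2_eq_square euclidean_inner[symmetric] norm_eq_1)
    moreover have "laplace_beltrami Y x = (\<Sum>b\<in>Basis. dirderiv b (dirderiv b Y) x)
      - 2 * real k * (\<Sum>b\<in>Basis. (x \<bullet> b) * dirderiv b Y x) - real DIM('a) * (real k * Y x)
      + real k * (real k + 2) * (\<Sum>b\<in>Basis. (x \<bullet> b)\<^sup>2) * Y x"
    proof -
      have "laplace_beltrami Y x = (\<Sum>b\<in>Basis. dirderiv b (dirderiv b Y) x
        - 2 * real k * ((x \<bullet> b) * dirderiv b Y x) - real k * Y x + real k * (real k + 2) * (x \<bullet> b)\<^sup>2 * Y x)"
        unfolding laplace_beltrami_def laplacian_eq_dirderiv by (rule sum.cong[OF refl d2[OF x]])
      then show ?thesis
        by (simp add: sum.distrib sum_subtractf sum_distrib_left sum_distrib_right)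
    qed
    ultimately show ?thesis
      using l[of x] by (simp add: laplacian_eq_dirderiv euler_homogeneous_sum[OF p h] algebra_simps)
  qed
  then show ?thesis
    using smooth_on_sphere_polynomial[OF p] by (simp add: laplace_eigenfunction_def)
qed

section \<open>Orthogonality of harmonics of different degrees\<close>

lemma integral_dirderiv_homogeneous:
  fixes f :: "'a::euclidean_space \<Rightarrow> real"
  assumes f: "real_polynomial_function f" and h: "homogeneous d f" and b: "b \<in> Basis"
  shows "(LINT x|sphere_measure. dirderiv b f x) =
    (real DIM('a) - 1 + real d) * (LINT x|sphere_measure. (x \<bullet> b) * f x)"
proof -
  \<comment> \<open>Euler's identity evaluates the radial part of the flow.\<close>
  have "coord_flow b f x = dirderiv b f x - real d * ((x \<bullet> b) * f x)" for x
  proof -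
    interpret D: linear "frechet_derivative f (at x)"
      by (rule has_derivative_linear[OF has_derivative_polynomial[OF f]])
    show ?thesis
      by (simp add: coord_flow_def D.diff D.scaleR euler_homogeneous[OF f h] dirderiv_def)
  qed
  moreover have "integrable sphere_measure (dirderiv b f)" "integrable sphere_measure (\<lambda>x. (x \<bullet> b) * f x)"
    by (intro integrable_sphere_measure continuous_on_polynomial real_polynomial_function_rules f)+
  ultimately have "(LINT x|sphere_measure. coord_flow b f x) =
     (LINT x|sphere_measure. dirderiv b f x) - real d * (LINT x|sphere_measure. (x \<bullet> b) * f x)"
    by simp
  then show ?thesis
    using integral_coord_flow[OF C1_on_sphere_polynomial[OF f] b] by (simp add: algebra_simps)
qed

text \<open>As \<open>Y\<close> is harmonic, the integrand is the divergence of \<open>Z\<close>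
  times the gradient of \<open>Y\<close>. The components of that field are homogeneous of degree
  \<open>j + k - 1\<close>, so each integrates by \<open>integral_dirderiv_homogeneous\<close>, and
  Euler's identity for \<open>Y\<close> sums them. The result weights \<open>Y\<close> and
  \<open>Z\<close> differently although the left-hand side is symmetric.\<close>

lemma integral_gradient_product:
  fixes Y Z :: "'a::euclidean_space \<Rightarrow> real"
  assumes Y: "solid_harmonic k Y" and Z: "solid_harmonic j Z"
  shows "(LINT x|sphere_measure. (\<Sum>b\<in>Basis. dirderiv b Z x * dirderiv b Y x)) =
    (real DIM('a) + real j + real k - 2) * real k * (LINT x|sphere_measure. Y x * Z x)"
proof (cases k)
  case 0
  then show ?thesis using Y by (simp add: dirderiv_solid_harmonic_0)
next
  case (Suc i)
  have pY: "real_polynomial_function Y" and pZ: "real_polynomial_function Z" and hY: "homogeneous k Y"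
    and hZ: "homogeneous j Z" and lY: "laplacian Y x = 0" for x
    using Y Z by (auto simp: solid_harmonic_def)
  let ?f = "\<lambda>b x. Z x * dirderiv b Y x"
  have pf: "real_polynomial_function (?f b)" for b
    using pY pZ by (intro real_polynomial_function_rules)
  have int: "integrable sphere_measure (dirderiv b (?f b))" "integrable sphere_measure (\<lambda>x. (x \<bullet> b) * ?f b x)" for b
    by (intro integrable_sphere_measure continuous_on_polynomial real_polynomial_function_rules pY pZ)+
  have "(\<Sum>b\<in>Basis. dirderiv b Z x * dirderiv b Y x) = (\<Sum>b\<in>Basis. dirderiv b (?f b) x)" for x
    using lY[of x]
    by (simp add: dirderiv_mult pY pZ real_polynomial_function_dirderiv sum.distrib laplacian_eq_dirderiv
        sum_distrib_left[symmetric])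
  then have "(LINT x|sphere_measure. (\<Sum>b\<in>Basis. dirderiv b Z x * dirderiv b Y x)) =
      (\<Sum>b\<in>Basis. LINT x|sphere_measure. dirderiv b (?f b) x)"
    by (simp only: Bochner_Integration.integral_sum[OF int(1)])
  also have "\<dots> = (\<Sum>b\<in>Basis. (real DIM('a) - 1 + real (j + i)) * (LINT x|sphere_measure. (x \<bullet> b) * ?f b x))"
    using hY hZ pY unfolding Suc
    by (intro sum.cong refl integral_dirderiv_homogeneous pf homogeneous_mult homogeneous_dirderiv)
  also have "\<dots> = (real DIM('a) - 1 + real (j + i)) * (LINT x|sphere_measure. (\<Sum>b\<in>Basis. (x \<bullet> b) * ?f b x))"
    by (simp only: Bochner_Integration.integral_sum[OF int(2)] sum_distrib_left)
  also have "(\<lambda>x. \<Sum>b\<in>Basis. (x \<bullet> b) * ?f b x) = (\<lambda>x. real k * (Y x * Z x))"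
  proof
    fix x
    have "(\<Sum>b\<in>Basis. (x \<bullet> b) * ?f b x) = Z x * (\<Sum>b\<in>Basis. (x \<bullet> b) * dirderiv b Y x)"
      by (simp add: sum_distrib_left algebra_simps)
    then show "(\<Sum>b\<in>Basis. (x \<bullet> b) * ?f b x) = real k * (Y x * Z x)"
      by (simp add: euler_homogeneous_sum[OF pY hY])
  qed
  finally show ?thesis by (simp add: Suc)
qed

text \<open>Exchanging the roles of \<open>Y\<close> and \<open>Z\<close> computes the same gradient
  integral with \<open>k\<close> and with \<open>j\<close>; the common factor \<open>?s\<close> is
  positive.\<close>

lemma solid_harmonic_orthogonal:
  fixes Y Z :: "'a::euclidean_space \<Rightarrow> real"
  assumes Y: "solid_harmonic k Y" and Z: "solid_harmonic j Z" and "j \<noteq> k" and D: "DIM('a) > 2"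
  shows "(LINT x|sphere_measure. Y x * Z x) = 0"
proof -
  let ?I = "LINT x|sphere_measure. Y x * Z x" and ?s = "real DIM('a) + real j + real k - 2"
  have "?s * real k * ?I = ?s * real j * ?I"
    using integral_gradient_product[OF Y Z] integral_gradient_product[OF Z Y]
    by (auto simp: mult.commute add.commute add.left_commute)
  then have "?s * ((real k - real j) * ?I) = 0" by (simp add: algebra_simps)
  moreover have "?s \<noteq> 0" using D by linarith
  ultimately show ?thesis using \<open>j \<noteq> k\<close> by (metis mult_eq_0_iff right_minus_eq of_nat_eq_iff)
qed

text \<open>The eigenvalue \<open>p k\<close> is the rising product from \<open>k\<close> to
  \<open>k + n - 1\<close>. Both sides of the recurrence are the product from \<open>k\<close> to
  \<open>k + n\<close>. The lower bound isolates the factor \<open>k\<close>, the others being at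
  least 1; it keeps the ladder weights \<open>k / p k\<close> bounded.\<close>

lemma paneitz_symbol_ratio:
  fixes n k :: nat
  assumes "n \<ge> 2"
  defines "p \<equiv> \<lambda>k. paneitz_symbol n (real k * (real k + real n - 1))"
  shows "real k * p (Suc k) = (real k + real n) * p k"
    and "p 0 = 0" and "k \<ge> 1 \<Longrightarrow> real k \<le> p k"
proof -
  have p: "p k = (\<Prod>s<n. real k + real s)" for k
    unfolding p_def by (rule paneitz_symbol_harmonic) fact
  have "p (Suc k) * real k = real k * (\<Prod>s<n. real k + real (Suc s))"
    by (simp add: p add_ac)
  also have "\<dots> = (\<Prod>s<Suc n. real k + real s)"
    by (subst prod.lessThan_Suc_shift) simp
  also have "\<dots> = (real k + real n) * p k" by (simp add: p mult.commute)
  finally show "real k * p (Suc k) = (real k + real n) * p k" by (simp add: mult.commute)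
  show "p 0 = 0" using assms(1) unfolding p by (intro prod_zero) (auto intro: bexI[of _ 0])
  show "real k \<le> p k" if "k \<ge> 1"
  proof -
    have "(\<Prod>s\<in>{..<n} - {0}. real k + real s) \<ge> 1"
      by (rule prod_ge_1) (use that in auto)
    moreover have "p k = (real k + real 0) * (\<Prod>s\<in>{..<n} - {0}. real k + real s)"
      unfolding p by (rule prod.remove) (use assms(1) in auto)
    ultimately show ?thesis using mult_left_mono[of 1 _ "real k"] by simp
  qed
qed

text \<open>The derivative along \<open>b\<close> is a multiple of \<open>harmonic_down\<close>; the
  radial part is \<open>k\<close> times the product with the coordinate, which splits into raised
  and lowered parts.\<close>

lemma coord_flow_solid_harmonic:
  fixes Y :: "'a::euclidean_space \<Rightarrow> real"
  assumes Y: "solid_harmonic k Y" and x: "x \<in> sphere 0 1" and D: "DIM('a) > 2"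
  shows "coord_flow b Y x =
    (real k + real DIM('a) - 2) * harmonic_down k b Y x - real k * harmonic_up k b Y x"
proof -
  have p: "real_polynomial_function Y" and h: "homogeneous k Y" using Y by (auto simp: solid_harmonic_def)
  interpret D: linear "frechet_derivative Y (at x)"
    by (rule has_derivative_linear[OF has_derivative_polynomial[OF p]])
  have "coord_flow b Y x = dirderiv b Y x - real k * ((x \<bullet> b) * Y x)"
    by (simp add: coord_flow_def D.diff D.scaleR euler_homogeneous[OF p h] dirderiv_def)
  also have "dirderiv b Y x = (2 * real k + real DIM('a) - 2) * harmonic_down k b Y x"
    using D by (simp add: harmonic_down_def)
  finally show ?thesis using harmonic_up_down[OF x, of b Y k] by (simp add: algebra_simps)
qed

text \<open>Integrate the flow of \<open>F x * Y x\<close> and subtract the part where it falls on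
  \<open>Y\<close>. The dimension minus one gains \<open>k\<close> on the raised part and loses
  \<open>real k + real DIM('a) - 2\<close> on the lowered part.\<close>

lemma integral_coord_flow_harmonic:
  fixes Y F :: "'a::euclidean_space \<Rightarrow> real"
  assumes F: "C1_on_sphere F" and Y: "solid_harmonic k Y" and b: "b \<in> Basis" and D: "DIM('a) > 2"
  shows "(LINT x|sphere_measure. Y x * coord_flow b F x) =
    (real DIM('a) - 1 + real k) * (LINT x|sphere_measure. F x * harmonic_up k b Y x) +
    (1 - real k) * (LINT x|sphere_measure. F x * harmonic_down k b Y x)"
proof -
  have p: "real_polynomial_function Y" using Y by (simp add: solid_harmonic_def)
  have cF: "continuous_on (sphere 0 1) F" by (rule C1_on_sphere_imp_continuous_on[OF F])
  have pd: "real_polynomial_function (harmonic_down k b Y)" "real_polynomial_function (harmonic_up k b Y)"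
    unfolding harmonic_up_def[abs_def] harmonic_down_def[abs_def] by (intro real_polynomial_function_rules p)+
  note ints = integrable_sphere_measure continuous_on_mult continuous_on_polynomial cF pd p continuous_on_coord_flow F
    C1_on_sphere_polynomial real_polynomial_function_inner
  have i: "integrable sphere_measure (\<lambda>x. Y x * coord_flow b F x)"
    "integrable sphere_measure (\<lambda>x. F x * coord_flow b Y x)"
    "integrable sphere_measure (\<lambda>x. F x * harmonic_up k b Y x)"
    "integrable sphere_measure (\<lambda>x. F x * harmonic_down k b Y x)"
    by (intro ints)+
  have "(LINT x|sphere_measure. Y x * coord_flow b F x) + (LINT x|sphere_measure. F x * coord_flow b Y x) =
      (LINT x|sphere_measure. coord_flow b (\<lambda>x. F x * Y x) x)"
    unfolding Bochner_Integration.integral_add[OF i(1,2), symmetric]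
    by (rule Bochner_Integration.integral_cong[OF refl])
      (simp add: coord_flow_mult[OF F C1_on_sphere_polynomial[OF p]])
  also have "\<dots> = (real DIM('a) - 1) * (LINT x|sphere_measure. F x * Y x * (x \<bullet> b))"
    by (rule integral_coord_flow[OF C1_on_sphere_mult[OF F C1_on_sphere_polynomial[OF p]] b])
  also have "(LINT x|sphere_measure. F x * Y x * (x \<bullet> b)) =
      (LINT x|sphere_measure. F x * harmonic_up k b Y x + F x * harmonic_down k b Y x)"
  proof (rule Bochner_Integration.integral_cong[OF refl])
    fix x :: 'a assume "x \<in> space sphere_measure"
    then show "F x * Y x * (x \<bullet> b) = F x * harmonic_up k b Y x + F x * harmonic_down k b Y x"
      using harmonic_up_down[of x b Y k] by (simp add: distrib_left[symmetric] mult.assoc mult.commute)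
  qed
  also have "\<dots> = (LINT x|sphere_measure. F x * harmonic_up k b Y x) + (LINT x|sphere_measure. F x * harmonic_down k b Y x)"
    by (rule Bochner_Integration.integral_add[OF i(3,4)])
  also have "(LINT x|sphere_measure. F x * coord_flow b Y x) =
      (LINT x|sphere_measure. (real k + real DIM('a) - 2) * (F x * harmonic_down k b Y x) - real k * (F x * harmonic_up k b Y x))"
    by (rule Bochner_Integration.integral_cong[OF refl])
      (simp add: coord_flow_solid_harmonic[OF Y _ D] algebra_simps)
  also have "\<dots> = (real k + real DIM('a) - 2) * (LINT x|sphere_measure. F x * harmonic_down k b Y x) -
      real k * (LINT x|sphere_measure. F x * harmonic_up k b Y x)"
    using i by simp
  finally show ?thesis by (simp add: algebra_simps)
qed

section \<open>Raising and lowering degrees\<close>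

lemma abs_integral_sphere_le:
  fixes f :: "'a::euclidean_space \<Rightarrow> real"
  assumes "continuous_on (sphere 0 1) f" "\<And>x. x \<in> sphere 0 1 \<Longrightarrow> \<bar>f x\<bar> \<le> B"
  shows "\<bar>LINT x|sphere_measure. f x\<bar> \<le> B"
proof -
  have "\<bar>LINT x|sphere_measure. f x\<bar> \<le> (LINT x|sphere_measure. \<bar>f x\<bar>)" by (rule integral_abs_bound)
  also have "\<dots> \<le> (LINT x|(sphere_measure :: 'a measure). B)"
    using assms by (intro integral_mono integrable_sphere_measure continuous_intros) auto
  finally show ?thesis by simp
qed

text \<open>The crude bound of \<open>\<bar>g x\<bar>\<close> by \<open>1 + (g x)\<^sup>2\<close>
  takes the place of the Cauchy-Schwarz inequality; linear dependence on \<open>B\<close> is what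
  matters, since \<open>B\<close> will tend to 0.\<close>

lemma abs_integral_mult_sphere_le:
  fixes f g :: "'a::euclidean_space \<Rightarrow> real"
  assumes f: "continuous_on (sphere 0 1) f" and g: "continuous_on (sphere 0 1) g"
    and B: "\<And>x. x \<in> sphere 0 1 \<Longrightarrow> \<bar>f x\<bar> \<le> B"
  shows "\<bar>LINT x|sphere_measure. f x * g x\<bar> \<le> B * (1 + (LINT x|sphere_measure. (g x)\<^sup>2))"
proof -
  have "\<bar>LINT x|sphere_measure. f x * g x\<bar> \<le> (LINT x|sphere_measure. \<bar>f x * g x\<bar>)" by (rule integral_abs_bound)
  also have "\<dots> \<le> (LINT x|sphere_measure. B * (1 + (g x)\<^sup>2))"
  proof (rule integral_mono)
    show "integrable sphere_measure (\<lambda>x. \<bar>f x * g x\<bar>)" "integrable sphere_measure (\<lambda>x. B * (1 + (g x)\<^sup>2))"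
      by (intro integrable_sphere_measure continuous_intros f g)+
    fix x :: 'a assume "x \<in> space sphere_measure"
    then have "\<bar>f x\<bar> \<le> B" using B by simp
    moreover have "\<bar>g x\<bar> \<le> 1 + (g x)\<^sup>2"
      using zero_le_power2[of "\<bar>g x\<bar> - 1"] by (simp add: power2_diff)
    ultimately show "\<bar>f x * g x\<bar> \<le> B * (1 + (g x)\<^sup>2)"
      unfolding abs_mult by (intro mult_mono) auto
  qed
  also have "\<dots> = B * (1 + (LINT x|sphere_measure. (g x)\<^sup>2))"
    by (simp add: integrable_sphere_measure continuous_intros g Bochner_Integration.integral_add)
  finally show ?thesis .
qed

lemma integral_sum_sq_orthogonal:
  fixes Z :: "'i \<Rightarrow> 'a::euclidean_space \<Rightarrow> real"
  assumes "finite I" "\<And>i. i \<in> I \<Longrightarrow> continuous_on (sphere 0 1) (Z i)"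
    and "\<And>i j. i \<in> I \<Longrightarrow> j \<in> I \<Longrightarrow> i \<noteq> j \<Longrightarrow> (LINT x|sphere_measure. Z i x * Z j x) = 0"
  shows "(LINT x|sphere_measure. (\<Sum>i\<in>I. Z i x)\<^sup>2) = (\<Sum>i\<in>I. LINT x|sphere_measure. (Z i x)\<^sup>2)"
proof -
  have "(LINT x|sphere_measure. (\<Sum>i\<in>I. Z i x)\<^sup>2) = (LINT x|sphere_measure. (\<Sum>i\<in>I. \<Sum>j\<in>I. Z i x * Z j x))"
    by (simp add: power2_eq_square sum_product)
  also have "\<dots> = (\<Sum>i\<in>I. LINT x|sphere_measure. (\<Sum>j\<in>I. Z i x * Z j x))"
    using assms(2) by (intro Bochner_Integration.integral_sum integrable_sphere_measure continuous_intros) auto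
  also have "\<dots> = (\<Sum>i\<in>I. \<Sum>j\<in>I. LINT x|sphere_measure. Z i x * Z j x)"
    using assms(2) by (intro sum.cong refl Bochner_Integration.integral_sum integrable_sphere_measure continuous_intros) auto
  also have "\<dots> = (\<Sum>i\<in>I. \<Sum>j\<in>I. if j = i then LINT x|sphere_measure. Z i x * Z j x else 0)"
    using assms(3) by (intro sum.cong refl) auto
  finally show ?thesis using assms(1) by (simp add: power2_eq_square)
qed

lemma continuous_on_solid_harmonic: "solid_harmonic k Y \<Longrightarrow> continuous_on S Y"
  by (simp add: solid_harmonic_def continuous_on_polynomial)

lemma continuous_on_harmonic_up_down:
  assumes "solid_harmonic k Y"
  shows "continuous_on S (harmonic_up k b Y)" "continuous_on S (harmonic_down k b Y)"
  using assms unfolding solid_harmonic_def harmonic_up_def[abs_def] harmonic_down_def[abs_def]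
  by (intro continuous_on_polynomial real_polynomial_function_rules; simp)+

text \<open>By orthogonality only neighbouring degrees interact, and there the other component drops
  out. The remaining integral is symmetric in \<open>Y\<close> and \<open>Z\<close>, so raising and
  lowering are adjoint to each other.\<close>

lemma integral_mult_harmonic_up_down:
  fixes Y Z :: "'a::euclidean_space \<Rightarrow> real"
  assumes Z: "solid_harmonic j Z" and Y: "solid_harmonic k Y" and b: "b \<in> Basis" and D: "DIM('a) > 2"
  shows "(LINT x|sphere_measure. Z x * harmonic_up k b Y x) =
      (if j = Suc k then LINT x|sphere_measure. (x \<bullet> b) * (Z x * Y x) else 0)"
    and "(LINT x|sphere_measure. Z x * harmonic_down k b Y x) =
      (if k = Suc j then LINT x|sphere_measure. (x \<bullet> b) * (Z x * Y x) else 0)"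
proof -
  have up: "(LINT x|sphere_measure. Z x * harmonic_up k b Y x) = 0" if "j \<noteq> Suc k"
    by (rule solid_harmonic_orthogonal[OF Z solid_harmonic_up[OF Y b D] _ D]) (use that in simp)
  have down: "(LINT x|sphere_measure. Z x * harmonic_down k b Y x) = 0" if "k \<noteq> Suc j"
  proof (cases k)
    case 0
    then show ?thesis using Y by (simp add: harmonic_down_0)
  next
    case (Suc i)
    then have "solid_harmonic i (harmonic_down k b Y)" using Y solid_harmonic_down by blast
    from solid_harmonic_orthogonal[OF Z this _ D] show ?thesis using that Suc by simp
  qed
  have "(LINT x|sphere_measure. (x \<bullet> b) * (Z x * Y x)) =
      (LINT x|sphere_measure. Z x * harmonic_up k b Y x + Z x * harmonic_down k b Y x)"
  proof (rule Bochner_Integration.integral_cong[OF refl])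
    fix x :: 'a assume "x \<in> space sphere_measure"
    then show "(x \<bullet> b) * (Z x * Y x) = Z x * harmonic_up k b Y x + Z x * harmonic_down k b Y x"
      using harmonic_up_down[of x b Y k] by (simp add: distrib_left[symmetric] mult.left_commute)
  qed
  also have "\<dots> = (LINT x|sphere_measure. Z x * harmonic_up k b Y x) + (LINT x|sphere_measure. Z x * harmonic_down k b Y x)"
    by (intro Bochner_Integration.integral_add integrable_sphere_measure continuous_intros
        continuous_on_harmonic_up_down[OF Y] continuous_on_solid_harmonic[OF Z])
  finally show "(LINT x|sphere_measure. Z x * harmonic_up k b Y x) =
      (if j = Suc k then LINT x|sphere_measure. (x \<bullet> b) * (Z x * Y x) else 0)"
    and "(LINT x|sphere_measure. Z x * harmonic_down k b Y x) =
      (if k = Suc j then LINT x|sphere_measure. (x \<bullet> b) * (Z x * Y x) else 0)"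
    using up down by auto
qed

text \<open>Pythagoras: the two parts are orthogonal and add up to the product of \<open>Y\<close>
  with a coordinate, which is at most 1 in absolute value.\<close>

lemma integral_harmonic_up_down_sq_le:
  fixes Y :: "'a::euclidean_space \<Rightarrow> real"
  assumes Y: "solid_harmonic k Y" and b: "b \<in> Basis" and D: "DIM('a) > 2"
  shows "(LINT x|sphere_measure. (harmonic_up k b Y x)\<^sup>2) \<le> (LINT x|sphere_measure. (Y x)\<^sup>2)"
    and "(LINT x|sphere_measure. (harmonic_down k b Y x)\<^sup>2) \<le> (LINT x|sphere_measure. (Y x)\<^sup>2)"
proof -
  let ?U = "harmonic_up k b Y" and ?W = "harmonic_down k b Y"
  have c: "continuous_on (sphere 0 1) ?U" "continuous_on (sphere 0 1) ?W" "continuous_on (sphere 0 1) Y"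
    by (intro continuous_on_harmonic_up_down[OF Y] continuous_on_solid_harmonic[OF Y])+
  note ints = integrable_sphere_measure continuous_intros c
  have UW: "(LINT x|sphere_measure. ?U x * ?W x) = 0"
    using integral_mult_harmonic_up_down(2)[OF solid_harmonic_up[OF Y b D] Y b D] by simp
  have "(LINT x|sphere_measure. (?U x)\<^sup>2) + (LINT x|sphere_measure. (?W x)\<^sup>2) =
      (LINT x|sphere_measure. (?U x)\<^sup>2 + (?W x)\<^sup>2 + 2 * (?U x * ?W x))"
    by (simp add: UW ints del: power2_eq_square)
  also have "\<dots> \<le> (LINT x|sphere_measure. (Y x)\<^sup>2)"
  proof (rule integral_mono)
    show "integrable sphere_measure (\<lambda>x. (?U x)\<^sup>2 + (?W x)\<^sup>2 + 2 * (?U x * ?W x))"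
      "integrable sphere_measure (\<lambda>x. (Y x)\<^sup>2)"
      by (intro ints)+
    fix x :: 'a assume x: "x \<in> space sphere_measure"
    have "(?U x)\<^sup>2 + (?W x)\<^sup>2 + 2 * (?U x * ?W x) = (x \<bullet> b)\<^sup>2 * (Y x)\<^sup>2"
      using harmonic_up_down[of x b Y k] x by (simp add: power_mult_distrib[symmetric] power2_sum)
    also have "\<dots> \<le> 1 * (Y x)\<^sup>2"
    proof (rule mult_right_mono)
      have "\<bar>x \<bullet> b\<bar> \<le> 1" using Cauchy_Schwarz_ineq2[of x b] x b by simp
      then show "(x \<bullet> b)\<^sup>2 \<le> 1" by (simp add: abs_square_le_1)
    qed simp
    finally show "(?U x)\<^sup>2 + (?W x)\<^sup>2 + 2 * (?U x * ?W x) \<le> (Y x)\<^sup>2" by simp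
  qed
  finally have *: "(LINT x|sphere_measure. (?U x)\<^sup>2) + (LINT x|sphere_measure. (?W x)\<^sup>2) \<le> (LINT x|sphere_measure. (Y x)\<^sup>2)" .
  have "(LINT x|sphere_measure. (?U x)\<^sup>2) \<ge> 0" "(LINT x|sphere_measure. (?W x)\<^sup>2) \<ge> 0" by simp_all
  with * show "(LINT x|sphere_measure. (?U x)\<^sup>2) \<le> (LINT x|sphere_measure. (Y x)\<^sup>2)"
    and "(LINT x|sphere_measure. (?W x)\<^sup>2) \<le> (LINT x|sphere_measure. (Y x)\<^sup>2)"
    by linarith+
qed

section \<open>The weighted ladder operator\<close>

context
  fixes b :: "'a::euclidean_space" and a :: "nat \<Rightarrow> real" and Q :: "nat \<Rightarrow> 'a \<Rightarrow> real" and N :: nat and T q :: "'a \<Rightarrow> real"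
  assumes b: "b \<in> Basis" and D: "DIM('a) > 2" and Q: "\<And>k. solid_harmonic k (Q k)"
  defines "q \<equiv> \<lambda>x. \<Sum>k\<le>N. Q k x"
  defines "T \<equiv> \<lambda>x. \<Sum>k\<le>N. a k * harmonic_up k b (Q k) x - a (k - 1) * harmonic_down k b (Q k) x"
begin

text \<open>Between degrees \<open>k\<close> and \<open>k + 1\<close> both directions carry the
  weight \<open>a k\<close>, with opposite signs, and the two are adjoint. The truncated
  \<open>k - 1\<close> at \<open>k = 0\<close> is harmless because \<open>harmonic_down\<close>
  vanishes there.\<close>

lemma harmonic_ladder_antisymmetric: "(LINT x|sphere_measure. q x * T x) = 0"
proof -
  let ?c = "\<lambda>j k. LINT x|sphere_measure. (x \<bullet> b) * (Q j x * Q k x)"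
  let ?t = "\<lambda>k x. a k * harmonic_up k b (Q k) x - a (k - 1) * harmonic_down k b (Q k) x"
  define B where "B j k = (LINT x|sphere_measure. Q j x * ?t k x)" for j k
  note cont = continuous_intros continuous_on_harmonic_up_down[OF Q] continuous_on_solid_harmonic[OF Q]
  have B: "B j k = (if j = Suc k then a k * ?c j k else 0) - (if k = Suc j then a j * ?c j k else 0)" for j k
  proof -
    have "B j k = (LINT x|sphere_measure. a k * (Q j x * harmonic_up k b (Q k) x) - a (k - 1) * (Q j x * harmonic_down k b (Q k) x))"
      by (simp add: B_def algebra_simps)
    also have "\<dots> = a k * (LINT x|sphere_measure. Q j x * harmonic_up k b (Q k) x) -
        a (k - 1) * (LINT x|sphere_measure. Q j x * harmonic_down k b (Q k) x)"
      by (simp add: integrable_sphere_measure cont)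
    finally show ?thesis by (simp add: integral_mult_harmonic_up_down[OF Q Q b D])
  qed
  \<comment> \<open>For neighbouring degrees both entries contain the weight of the smaller degree
    and the same symmetric integral.\<close>
  have anti: "B j k = - B k j" for j k by (auto simp: B mult.commute)
  have "(LINT x|sphere_measure. q x * T x) = (LINT x|sphere_measure. (\<Sum>j\<le>N. \<Sum>k\<le>N. Q j x * ?t k x))"
    by (simp add: q_def T_def sum_product)
  also have "\<dots> = (\<Sum>j\<le>N. LINT x|sphere_measure. (\<Sum>k\<le>N. Q j x * ?t k x))"
    by (intro Bochner_Integration.integral_sum integrable_sphere_measure cont)
  also have "\<dots> = (\<Sum>j\<le>N. \<Sum>k\<le>N. B j k)"
    unfolding B_def by (intro sum.cong refl Bochner_Integration.integral_sum integrable_sphere_measure cont)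
  finally have S: "(LINT x|sphere_measure. q x * T x) = (\<Sum>j\<le>N. \<Sum>k\<le>N. B j k)" .
  have "(\<Sum>j\<le>N. \<Sum>k\<le>N. B j k) = (\<Sum>j\<le>N. \<Sum>k\<le>N. B k j)" by (rule sum.swap)
  also have "\<dots> = - (\<Sum>j\<le>N. \<Sum>k\<le>N. B j k)"
    by (subst anti) (simp add: sum_negf)
  finally show ?thesis using S by simp
qed

text \<open>The raised parts of distinct components are mutually orthogonal, and so are the lowered
  ones, so neither sum has a larger square integral than \<open>q\<close>. The factor 4 comes from
  bounding the square of a difference by twice the sum of squares.\<close>

lemma harmonic_ladder_bounded:
  assumes a: "\<And>k. \<bar>a k\<bar> \<le> 1"
  shows "(LINT x|sphere_measure. (T x)\<^sup>2) \<le> 4 * (LINT x|sphere_measure. (q x)\<^sup>2)"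
proof -
  let ?u = "\<lambda>k x. a k * harmonic_up k b (Q k) x" and ?w = "\<lambda>k x. a (k - 1) * harmonic_down k b (Q k) x"
  let ?U = "\<lambda>x. \<Sum>k\<le>N. ?u k x" and ?W = "\<lambda>x. \<Sum>k\<le>N. ?w k x"
  note cont = continuous_intros continuous_on_harmonic_up_down[OF Q] continuous_on_solid_harmonic[OF Q]
  have a2: "(a k)\<^sup>2 \<le> 1" for k using a by (simp add: abs_square_le_1)
  have q2: "(LINT x|sphere_measure. (q x)\<^sup>2) = (\<Sum>k\<le>N. LINT x|sphere_measure. (Q k x)\<^sup>2)"
    unfolding q_def by (rule integral_sum_sq_orthogonal)
      (auto intro!: cont intro: solid_harmonic_orthogonal[OF Q Q _ D])
  have le: "(LINT x|sphere_measure. (c * f x)\<^sup>2) \<le> (LINT x|sphere_measure. (g x)\<^sup>2)"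
    if "c\<^sup>2 \<le> 1" "(LINT x|sphere_measure. (f x)\<^sup>2) \<le> (LINT x|sphere_measure. (g x)\<^sup>2)" for c and f g :: "'a \<Rightarrow> real"
  proof -
    have "(LINT x|sphere_measure. (c * f x)\<^sup>2) = c\<^sup>2 * (LINT x|sphere_measure. (f x)\<^sup>2)"
      by (simp add: power_mult_distrib)
    also have "\<dots> \<le> 1 * (LINT x|sphere_measure. (f x)\<^sup>2)"
      using that(1) by (intro mult_right_mono) auto
    finally show ?thesis using that(2) by simp
  qed
  have U: "(LINT x|sphere_measure. (?U x)\<^sup>2) \<le> (LINT x|sphere_measure. (q x)\<^sup>2)"
  proof -
    have "(LINT x|sphere_measure. (?U x)\<^sup>2) = (\<Sum>k\<le>N. LINT x|sphere_measure. (?u k x)\<^sup>2)"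
    proof (rule integral_sum_sq_orthogonal)
      fix i j :: nat assume "i \<noteq> j"
      then show "(LINT x|sphere_measure. ?u i x * ?u j x) = 0"
        by (intro solid_harmonic_orthogonal[OF _ _ _ D, of "Suc i" _ "Suc j"] solid_harmonic_cmult solid_harmonic_up Q b D) simp
    qed (auto intro!: cont)
    also have "\<dots> \<le> (\<Sum>k\<le>N. LINT x|sphere_measure. (Q k x)\<^sup>2)"
      by (intro sum_mono le a2 integral_harmonic_up_down_sq_le Q b D)
    finally show ?thesis by (simp add: q2)
  qed
  have W: "(LINT x|sphere_measure. (?W x)\<^sup>2) \<le> (LINT x|sphere_measure. (q x)\<^sup>2)"
  proof -
    have "(LINT x|sphere_measure. (?W x)\<^sup>2) = (\<Sum>k\<le>N. LINT x|sphere_measure. (?w k x)\<^sup>2)"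
    proof (rule integral_sum_sq_orthogonal)
      fix i j :: nat assume ij: "i \<noteq> j"
      show "(LINT x|sphere_measure. ?w i x * ?w j x) = 0"
      \<comment> \<open>The lowered part of degree 0 is zero; the others have degrees one less than
        their indices, still distinct.\<close>
      proof (cases "i = 0 \<or> j = 0")
        case True
        then show ?thesis using harmonic_down_0[OF Q[of 0]] by auto
      next
        case False
        then obtain i' j' where i': "i = Suc i'" "j = Suc j'" by (metis not0_implies_Suc)
        show ?thesis unfolding i'
          by (intro solid_harmonic_orthogonal[OF _ _ _ D, of i' _ j'] solid_harmonic_cmult solid_harmonic_down Q)
            (use ij i' in simp)
      qed
    qed (auto intro!: cont)
    also have "\<dots> \<le> (\<Sum>k\<le>N. LINT x|sphere_measure. (Q k x)\<^sup>2)"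
      by (intro sum_mono le a2 integral_harmonic_up_down_sq_le Q b D)
    finally show ?thesis by (simp add: q2)
  qed
  have "(LINT x|sphere_measure. (T x)\<^sup>2) \<le> (LINT x|sphere_measure. 2 * (?U x)\<^sup>2 + 2 * (?W x)\<^sup>2)"
  proof (rule integral_mono)
    show "integrable sphere_measure (\<lambda>x. (T x)\<^sup>2)"
      unfolding T_def by (intro integrable_sphere_measure cont)
    show "integrable sphere_measure (\<lambda>x. 2 * (?U x)\<^sup>2 + 2 * (?W x)\<^sup>2)"
      by (intro integrable_sphere_measure cont)
    show "(T x)\<^sup>2 \<le> 2 * (?U x)\<^sup>2 + 2 * (?W x)\<^sup>2" for x
      using zero_le_power2[of "?U x + ?W x"] unfolding T_def sum_subtractf power2_sum power2_diff by linarith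
  qed
  also have "\<dots> = 2 * (LINT x|sphere_measure. (?U x)\<^sup>2) + 2 * (LINT x|sphere_measure. (?W x)\<^sup>2)"
    by (simp add: integrable_sphere_measure cont)
  finally show ?thesis using U W by linarith
qed

end

section \<open>The Paneitz operator\<close>

text \<open>Conformal invariance of the quadratic form of the Paneitz operator, infinitesimally along the
  gradient of a coordinate. For a harmonic sum \<open>q\<close> close to \<open>v\<close>, integration by parts turns
  \<open>\<integral> q (X F)\<close> into \<open>\<integral> v (T q)\<close>, where \<open>T\<close> raises and lowers degrees; \<open>T\<close> is bounded and
  antisymmetric, so \<open>\<integral> v (T q) = \<integral> (v - q) (T q)\<close> is small.\<close>

lemma integral_paneitz_coord_flow:
  fixes F v :: "'a::euclidean_space \<Rightarrow> real"
  assumes n: "DIM('a) = n + 1" "n \<ge> 2" and b: "b \<in> Basis"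
    and F: "C1_on_sphere F" and v: "continuous_on (sphere 0 1) v"
    and pan: "\<And>k Y. solid_harmonic k Y \<Longrightarrow> (LINT x|sphere_measure. v x * Y x) =
      paneitz_symbol n (real k * (real k + real n - 1)) * (LINT x|sphere_measure. F x * Y x)"
  shows "(LINT x|sphere_measure. v x * coord_flow b F x) = 0"
proof -
  define p where "p k = paneitz_symbol n (real k * (real k + real n - 1))" for k
  \<comment> \<open>These weights satisfy \<open>a k * p (Suc k) = real k + real n\<close> for
    \<open>k \<ge> 1\<close> and \<open>a k * p k = real k\<close>, which converts the coefficients
    of \<open>integral_coord_flow_harmonic\<close> from \<open>F\<close> to \<open>v\<close>. At
    \<open>k = 0\<close> the division by \<open>p 0 = 0\<close> gives
    \<open>a 0 = 0\<close>.\<close>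
  define a where "a k = real k / p k" for k
  have D: "DIM('a) > 2" using n by simp
  have ps: "real k * p (Suc k) = (real k + real n) * p k" and p0: "p 0 = 0" and pk: "k \<ge> 1 \<Longrightarrow> real k \<le> p k" for k
    using paneitz_symbol_ratio[OF n(2)] unfolding p_def by blast+
  have ppos: "p k > 0" if "k \<ge> 1" for k using pk[OF that] that by linarith
  have a0: "a 0 = 0" by (simp add: a_def)
  have a1: "\<bar>a k\<bar> \<le> 1" for k
    using pk[of k] ppos[of k] by (cases "k = 0") (auto simp: a_def)
  have pan': "(LINT x|sphere_measure. v x * Y x) = p k * (LINT x|sphere_measure. F x * Y x)"
    if "solid_harmonic k Y" for k Y
    using pan[OF that] by (simp add: p_def)
  \<comment> \<open>Degree 0 is excluded: there raising has coefficient \<open>n\<close> on the side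
    of \<open>F\<close>, but the weight \<open>a 0\<close> is 0.\<close>
  have ladder: "(LINT x|sphere_measure. Y x * coord_flow b F x) =
      (LINT x|sphere_measure. v x * (a k * harmonic_up k b Y x - a (k - 1) * harmonic_down k b Y x))"
    if Y: "solid_harmonic k Y" and k: "k \<ge> 1" for k Y
  proof -
    obtain j where j: "k = Suc j" using k by (cases k) auto
    let ?u = "LINT x|sphere_measure. F x * harmonic_up k b Y x"
    let ?w = "LINT x|sphere_measure. F x * harmonic_down k b Y x"
    have "(LINT x|sphere_measure. v x * (a k * harmonic_up k b Y x - a (k - 1) * harmonic_down k b Y x)) =
        (LINT x|sphere_measure. a k * (v x * harmonic_up k b Y x) - a j * (v x * harmonic_down k b Y x))"
      by (simp add: j algebra_simps)
    also have "\<dots> = a k * (LINT x|sphere_measure. v x * harmonic_up k b Y x) - a j * (LINT x|sphere_measure. v x * harmonic_down k b Y x)"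
      by (simp add: integrable_sphere_measure continuous_intros v continuous_on_harmonic_up_down[OF Y])
    also have "(LINT x|sphere_measure. v x * harmonic_up k b Y x) = p (Suc k) * ?u"
      by (intro pan' solid_harmonic_up Y b D)
    also have "(LINT x|sphere_measure. v x * harmonic_down k b Y x) = p j * ?w"
      using Y unfolding j by (intro pan' solid_harmonic_down)
    also have "a k * (p (Suc k) * ?u) = (real k + real n) * ?u"
    proof -
      have "a k * p (Suc k) = real k + real n" using ps[of k] ppos[OF k] by (simp add: a_def field_simps)
      then show ?thesis by (simp only: mult.assoc[symmetric])
    qed
    also have "a j * (p j * ?w) = real j * ?w"
      using ppos[of j] by (cases "j = 0") (auto simp: a_def)
    finally show ?thesis
      using integral_coord_flow_harmonic[OF F Y b D] by (simp add: n j algebra_simps)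
  qed
  have cX: "continuous_on (sphere 0 1) (coord_flow b F)" by (rule continuous_on_coord_flow[OF F])
  obtain M where M: "\<And>x. x \<in> sphere 0 1 \<Longrightarrow> \<bar>v x\<bar> \<le> M"
  proof -
    have "bounded (v ` sphere 0 1)" using v by (intro compact_imp_bounded compact_continuous_image) auto
    then show ?thesis using that unfolding bounded_iff real_norm_def by blast
  qed
  \<comment> \<open>The two summands bound the factors multiplying \<open>e\<close> for the flow of
    \<open>F\<close> and for \<open>T\<close>; neither depends on \<open>e\<close>.\<close>
  define K where "K = (1 + (LINT x|sphere_measure. (coord_flow b F x)\<^sup>2)) + (1 + 4 * (M + 1)\<^sup>2)"
  let ?I = "LINT x|sphere_measure. v x * coord_flow b F x"
  have bound: "\<bar>?I\<bar> \<le> e * K" if e: "0 < e" "e \<le> 1" for e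
  proof -
    obtain g where g: "real_polynomial_function g" "\<And>x. x \<in> sphere 0 1 \<Longrightarrow> \<bar>v x - g x\<bar> < e / 2"
      using Stone_Weierstrass_real_polynomial_function[OF compact_sphere v, of "e / 2"] e(1) by auto
    obtain N R where R: "\<And>k. solid_harmonic k (R k)"
      and gR: "\<And>x. x \<in> sphere 0 1 \<Longrightarrow> g x = (\<Sum>k\<le>N. R k x)"
      using polynomial_harmonic_decomposition[OF g(1) D] unfolding harmonic_sum_on_sphere_def by metis
    \<comment> \<open>The constant component is dropped, since \<open>ladder\<close> starts at
      degree 1. The loss is small because \<open>v\<close> has mean zero.\<close>
    define Q where "Q k = (if k = 0 then (\<lambda>x. 0) else R k)" for k
    have Q: "solid_harmonic k (Q k)" for k using R by (simp add: Q_def solid_harmonic_zero)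
    define q where "q x = (\<Sum>k\<le>N. Q k x)" for x
    define T where "T x = (\<Sum>k\<le>N. a k * harmonic_up k b (Q k) x - a (k - 1) * harmonic_down k b (Q k) x)" for x
    note cont = continuous_intros continuous_on_harmonic_up_down[OF Q] continuous_on_solid_harmonic[OF Q] v cX
    have cq: "continuous_on (sphere 0 1) q" and cT: "continuous_on (sphere 0 1) T"
      unfolding q_def[abs_def] T_def[abs_def] by (intro cont)+
    note cont = cont cq cT
    have R0: "R 0 x = R 0 0" for x
      using R[of 0] homogeneous_0_polynomial by (auto simp: solid_harmonic_def)
    have qg: "g x = R 0 0 + q x" if "x \<in> sphere 0 1" for x
    proof -
      have "(\<Sum>k\<le>N. R k x) = R 0 x + (\<Sum>k\<in>{..N} - {0}. R k x)" by (rule sum.remove) auto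
      moreover have "q x = Q 0 x + (\<Sum>k\<in>{..N} - {0}. Q k x)" unfolding q_def by (rule sum.remove) auto
      ultimately show ?thesis using gR[OF that] R0[of x] by (simp add: Q_def)
    qed
    have "(LINT x|sphere_measure. q x) = (\<Sum>k\<le>N. LINT x|sphere_measure. Q k x)"
      unfolding q_def by (intro Bochner_Integration.integral_sum integrable_sphere_measure cont)
    also have "\<dots> = 0"
    proof (intro sum.neutral ballI)
      fix k
      show "(LINT x|sphere_measure. Q k x) = 0"
        using solid_harmonic_orthogonal[OF Q solid_harmonic_const[of 1] _ D, of k] by (cases "k = 0") (auto simp: Q_def)
    qed
    finally have q0: "(LINT x|sphere_measure. q x) = 0" .
    have v0: "(LINT x|sphere_measure. v x) = 0"
      using pan'[OF solid_harmonic_const[of 1]] by (simp add: p0)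
    have "(LINT x|sphere_measure. g x - v x) = (LINT x|sphere_measure. (R 0 0 + q x) - v x)"
      by (rule Bochner_Integration.integral_cong) (simp_all add: qg)
    also have "\<dots> = R 0 0"
      using q0 v0 by (simp add: integrable_sphere_measure cont)
    \<comment> \<open>As \<open>v\<close> and \<open>q\<close> have mean zero, the dropped constant
      is the mean of \<open>g - v\<close>, at most \<open>e / 2\<close>; dropping it costs another
      \<open>e / 2\<close> in the approximation of \<open>v\<close>.\<close>
    finally have R00: "(LINT x|sphere_measure. g x - v x) = R 0 0" .
    have "\<bar>LINT x|sphere_measure. g x - v x\<bar> \<le> e / 2"
    proof (rule abs_integral_sphere_le)
      show "continuous_on (sphere 0 1) (\<lambda>x. g x - v x)"
        by (intro continuous_intros v continuous_on_polynomial g(1))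
      show "\<bar>g x - v x\<bar> \<le> e / 2" if "x \<in> sphere 0 1" for x
        using g(2)[OF that] by linarith
    qed
    then have "\<bar>R 0 0\<bar> \<le> e / 2" by (simp only: R00)
    then have vq: "\<bar>v x - q x\<bar> \<le> e" if "x \<in> sphere 0 1" for x
      using g(2)[OF that] qg[OF that] by linarith
    have step: "(LINT x|sphere_measure. Q k x * coord_flow b F x) =
        (LINT x|sphere_measure. v x * (a k * harmonic_up k b (Q k) x - a (k - 1) * harmonic_down k b (Q k) x))" for k
    proof (cases "k = 0")
      case True
      then show ?thesis using True by (simp add: a0 Q_def)
    next
      case False
      then show ?thesis by (intro ladder Q) simp
    qed
    have "(LINT x|sphere_measure. q x * coord_flow b F x) = (LINT x|sphere_measure. (\<Sum>k\<le>N. Q k x * coord_flow b F x))"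
      by (simp add: q_def sum_distrib_right)
    also have "\<dots> = (\<Sum>k\<le>N. LINT x|sphere_measure. Q k x * coord_flow b F x)"
      by (intro Bochner_Integration.integral_sum integrable_sphere_measure cont)
    also have "\<dots> = (LINT x|sphere_measure. (\<Sum>k\<le>N. v x * (a k * harmonic_up k b (Q k) x - a (k - 1) * harmonic_down k b (Q k) x)))"
      unfolding step by (intro Bochner_Integration.integral_sum[symmetric] integrable_sphere_measure cont)
    also have "\<dots> = (LINT x|sphere_measure. v x * T x)"
      by (simp add: T_def sum_distrib_left)
    finally have qX: "(LINT x|sphere_measure. q x * coord_flow b F x) = (LINT x|sphere_measure. v x * T x)" .
    have qT: "(LINT x|sphere_measure. q x * T x) = 0"
      unfolding q_def T_def by (rule harmonic_ladder_antisymmetric[OF b D Q])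
    have T2: "(LINT x|sphere_measure. (T x)\<^sup>2) \<le> 4 * (M + 1)\<^sup>2"
    proof -
      have "(LINT x|sphere_measure. (T x)\<^sup>2) \<le> 4 * (LINT x|sphere_measure. (q x)\<^sup>2)"
        unfolding q_def T_def by (rule harmonic_ladder_bounded[OF b D Q a1])
      moreover have "\<bar>LINT x|sphere_measure. (q x)\<^sup>2\<bar> \<le> (M + 1)\<^sup>2"
      proof (rule abs_integral_sphere_le)
        fix x :: 'a assume x: "x \<in> sphere 0 1"
        have "\<bar>q x\<bar> \<le> M + 1" using M[OF x] vq[OF x] e by linarith
        then show "\<bar>(q x)\<^sup>2\<bar> \<le> (M + 1)\<^sup>2" using power_mono[of "\<bar>q x\<bar>" "M + 1" 2] by simp
      qed (intro cont)
      ultimately show ?thesis by linarith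
    qed
    have "?I = (LINT x|sphere_measure. (v x - q x) * coord_flow b F x) + (LINT x|sphere_measure. q x * coord_flow b F x)"
      by (simp add: left_diff_distrib integrable_sphere_measure cont)
    \<comment> \<open>Antisymmetry allows \<open>q\<close> to be subtracted from \<open>v\<close>,
      so both remaining integrals contain the small factor \<open>v - q\<close>.\<close>
    also have "(LINT x|sphere_measure. q x * coord_flow b F x) = (LINT x|sphere_measure. (v x - q x) * T x)"
      using qT by (simp add: qX left_diff_distrib integrable_sphere_measure cont)
    finally have "\<bar>?I\<bar> \<le> \<bar>LINT x|sphere_measure. (v x - q x) * coord_flow b F x\<bar> + \<bar>LINT x|sphere_measure. (v x - q x) * T x\<bar>"
      by linarith
    also have "\<dots> \<le> e * (1 + (LINT x|sphere_measure. (coord_flow b F x)\<^sup>2)) + e * (1 + (LINT x|sphere_measure. (T x)\<^sup>2))"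
      by (intro add_mono abs_integral_mult_sphere_le vq cont)
    also have "\<dots> \<le> e * K"
      using e(1) T2 by (simp add: K_def distrib_left[symmetric])
    finally show ?thesis .
  qed
  have "\<bar>?I\<bar> \<le> 0"
  proof (rule tendsto_lowerbound)
    show "at_right (0::real) \<noteq> bot" by simp
    show "((\<lambda>e. e * K) \<longlongrightarrow> 0) (at_right 0)"
      by (rule tendsto_eq_intros tendsto_ident_at refl | simp)+
    have "eventually (\<lambda>e::real. e \<in> {0<..<1}) (at_right 0)" by (rule eventually_at_right_real) simp
    then show "eventually (\<lambda>e. \<bar>?I\<bar> \<le> e * K) (at_right 0)"
      by eventually_elim (use bound in simp)
  qed
  then show ?thesis by simp
qed

section \<open>The integral identities for solutions of the equation\<close>

lemma smooth_on_sphere_C1_extension: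
  assumes "smooth_on_sphere u"
  obtains F where "C1_on_sphere F" "\<And>x. x \<in> sphere 0 1 \<Longrightarrow> F x = u x"
proof -
  obtain U F where U: "open U" "sphere 0 1 \<subseteq> U" "smooth_on U F" "\<forall>x\<in>sphere 0 1. F x = u x"
    using assms unfolding smooth_on_sphere_def by blast
  have "C_k_on (Suc 0) U F" using U(3) unfolding smooth_on_def by blast
  then have "C1_on_sphere F"
    using U(2) unfolding C1_on_sphere_def by (auto intro: continuous_on_subset)
  with U(4) show ?thesis using that by blast
qed

theorem proposition1p5:
  fixes n :: nat
    and \<alpha> :: real
    and u Pu :: "real ^ 'm \<Rightarrow> real"
  assumes "CARD('m) = n + 1"
    and "n \<ge> 2"
    and "\<alpha> > 0"
    and "\<alpha> \<noteq> 1"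
    and "smooth_on_sphere u"
    and "has_paneitz n u Pu"
    and "\<forall>x\<in>sphere 0 1.
           \<alpha> * Pu x + fact (n - 1) *
             (1 - exp (real n * u x) / (LINT y|sphere_measure. exp (real n * u y))) = 0"
  shows "\<forall>i. (LINT x|sphere_measure. exp (real n * u x) * x $ i) = 0 \<and>
             (LINT x|sphere_measure. u x * x $ i) = 0"
proof
  fix i :: 'm
  let ?b = "axis i 1 :: real ^ 'm"
  have b: "?b \<in> Basis" by simp
  have dim: "DIM(real ^ 'm) = n + 1" using assms(1) by simp
  \<comment> \<open>The values of \<open>u\<close> off the sphere are arbitrary, so the flow is
    applied to an extension that agrees with \<open>u\<close> on the sphere.\<close>
  obtain F where F: "C1_on_sphere F" and Fu: "\<And>x. x \<in> sphere 0 1 \<Longrightarrow> F x = u x"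
    by (rule smooth_on_sphere_C1_extension[OF assms(5)]) blast
  have "smooth_on_sphere Pu" using assms(6) by (simp add: has_paneitz_def)
  then obtain V where V: "C1_on_sphere V" and Vv: "\<And>x. x \<in> sphere 0 1 \<Longrightarrow> V x = Pu x"
    by (rule smooth_on_sphere_C1_extension) blast
  have cF: "continuous_on (sphere 0 1) F" and cV: "continuous_on (sphere 0 1) V"
    using F V by (auto intro: C1_on_sphere_imp_continuous_on)
  have int_cong: "(LINT x|sphere_measure. f x) = (LINT x|sphere_measure. g x)"
    if "\<And>x. x \<in> sphere 0 1 \<Longrightarrow> f x = g x" for f g :: "real ^ 'm \<Rightarrow> real"
    using that by (intro Bochner_Integration.integral_cong) auto
  have pan: "(LINT x|sphere_measure. V x * Y x) =
      paneitz_symbol n (real k * (real k + real n - 1)) * (LINT x|sphere_measure. F x * Y x)"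
    if Y: "solid_harmonic k Y" for k and Y :: "real ^ 'm \<Rightarrow> real"
  proof -
    have "laplace_eigenfunction (real k * (real k + real n - 1)) Y"
      using laplace_eigenfunction_solid_harmonic[OF Y] by (simp add: dim assms(1) algebra_simps)
    then have "(LINT x|sphere_measure. Pu x * Y x) =
        paneitz_symbol n (real k * (real k + real n - 1)) * (LINT x|sphere_measure. u x * Y x)"
      using assms(6) unfolding has_paneitz_def by blast
    moreover have "(LINT x|sphere_measure. V x * Y x) = (LINT x|sphere_measure. Pu x * Y x)"
      "(LINT x|sphere_measure. F x * Y x) = (LINT x|sphere_measure. u x * Y x)"
      by (auto intro!: int_cong simp: Fu Vv)
    ultimately show ?thesis by simp
  qed
  let ?E = "\<lambda>x. exp (real n * F x)"
  define J where "J = (LINT x|sphere_measure. exp (real n * u x))"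
  define c where "c = (fact (n - 1) :: real)"
  have c: "c > 0" by (simp add: c_def)
  have eq: "\<alpha> * V x = c * (?E x / J - 1)" if "x \<in> sphere 0 1" for x
    using assms(7)[rule_format, OF that] Fu[OF that] Vv[OF that] unfolding J_def[symmetric] c_def[symmetric]
    by (simp add: algebra_simps)
  have EJ: "(LINT x|sphere_measure. ?E x) = J"
    unfolding J_def by (rule int_cong) (simp add: Fu)
  note ints = integrable_sphere_measure continuous_intros cF cV continuous_on_coord_flow F C1_on_sphere_exp
  \<comment> \<open>With \<open>J = 0\<close> the quotient in the equation would be 0 by convention,
    making \<open>Pu\<close> a nonzero constant on the sphere; but the mean of \<open>Pu\<close> is
    0, since the symbol vanishes in degree 0.\<close>
  have J0: "J \<noteq> 0"
  proof
    assume "J = 0"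
    then have "(LINT x|sphere_measure. \<alpha> * V x) = (LINT x|(sphere_measure :: (real ^ 'm) measure). - c)"
      by (intro int_cong) (simp add: eq)
    moreover have "(LINT x|sphere_measure. V x) = 0"
      using pan[OF solid_harmonic_const[of 1]] paneitz_symbol_ratio(2)[OF assms(2)] by simp
    ultimately show False using c by simp
  qed
  let ?e = "LINT x|sphere_measure. ?E x * (x \<bullet> ?b)" and ?f = "LINT x|sphere_measure. F x * (x \<bullet> ?b)"
  have flowF: "(LINT x|sphere_measure. coord_flow ?b F x) = real n * ?f"
    using integral_coord_flow[OF F b] by (simp add: assms(1))
  \<comment> \<open>Chain rule, followed by the divergence formula, whose constant is
    \<open>n\<close> on the \<open>n\<close>-sphere.\<close>
  have "(LINT x|sphere_measure. real n * (?E x * coord_flow ?b F x)) = (LINT x|sphere_measure. coord_flow ?b ?E x)"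
    by (rule int_cong) (simp add: coord_flow_exp[OF F])
  also have "\<dots> = real n * ?e"
    using integral_coord_flow[OF C1_on_sphere_exp[OF F] b] by (simp add: assms(1))
  finally have flowE: "(LINT x|sphere_measure. ?E x * coord_flow ?b F x) = ?e"
    using assms(2) by simp
  \<comment> \<open>The equation tested against the flow of \<open>F\<close>; the left-hand side is
    the conformal identity.\<close>
  have "0 = (LINT x|sphere_measure. \<alpha> * (V x * coord_flow ?b F x))"
    using integral_paneitz_coord_flow[OF dim assms(2) b F cV pan] by simp
  also have "\<dots> = (LINT x|sphere_measure. c / J * (?E x * coord_flow ?b F x) - c * coord_flow ?b F x)"
    by (rule int_cong) (use eq in \<open>simp add: mult.assoc[symmetric], simp add: algebra_simps\<close>)
  also have "\<dots> = c / J * ?e - c * (real n * ?f)"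
    by (simp add: ints flowE flowF)
  finally have "c * (?e / J - real n * ?f) = 0" by (simp add: algebra_simps)
  then have 1: "?e / J = real n * ?f" using c by (simp del: times_divide_eq_left times_divide_eq_right)
  have nc: "fact n = real n * c"
    using assms(2) fact_reduce[of n, where 'a = real] by (simp add: c_def)
  \<comment> \<open>Coordinates are harmonic of degree 1, with eigenvalue \<open>n!\<close>.\<close>
  have "paneitz_symbol n (real 1 * (real 1 + real n - 1)) = (\<Prod>s<n. real 1 + real s)"
    by (rule paneitz_symbol_harmonic[OF assms(2)])
  also have "\<dots> = fact n" by (simp add: fact_prod_Suc lessThan_atLeast0 add.commute)
  finally have "(LINT x|sphere_measure. V x * (x \<bullet> ?b)) = fact n * ?f"
    using pan[OF solid_harmonic_inner, of ?b] by simp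
  then have "\<alpha> * (fact n * ?f) = (LINT x|sphere_measure. \<alpha> * (V x * (x \<bullet> ?b)))"
    by simp
  also have "\<dots> = (LINT x|sphere_measure. c / J * (?E x * (x \<bullet> ?b)) - c * (x \<bullet> ?b))"
    by (rule int_cong) (use eq in \<open>simp add: mult.assoc[symmetric], simp add: algebra_simps\<close>)
  also have "\<dots> = c / J * ?e - c * (LINT x|sphere_measure. x \<bullet> ?b)"
    by (simp add: ints)
  also have "(LINT x|sphere_measure. x \<bullet> ?b) = 0"
    using solid_harmonic_orthogonal[OF solid_harmonic_inner[of ?b] solid_harmonic_const[of 1]] assms(2) by (simp add: dim assms(1))
  also have "c / J * ?e - c * 0 = c * (?e / J)" by simp
  also have "\<dots> = fact n * ?f" unfolding 1 nc by simp
  \<comment> \<open>Testing against the coordinate gives \<open>?f\<close> the factor \<alpha> n! on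
    one side and n! on the other, so it vanishes as \<alpha> differs from 1.\<close>
  finally have f0: "?f = 0" using assms(2,4) c by (simp add: nc)
  then have e0: "?e = 0" using 1 J0 by simp
  have "(LINT x|sphere_measure. exp (real n * u x) * x $ i) = ?e" "(LINT x|sphere_measure. u x * x $ i) = ?f"
    by (auto intro!: int_cong simp: Fu inner_axis)
  then show "(LINT x|sphere_measure. exp (real n * u x) * x $ i) = 0 \<and> (LINT x|sphere_measure. u x * x $ i) = 0"
    using e0 f0 by simp
qed

end
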